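(* Let $\mathcal H$ be a real Hilbert space and let $U_i\colon\mathcal{H}\to\mathcal{H}$ be a cutter for each $i\in I:=\{1,\ldots,M\}$, such that $C:=\bigcap_{i\in I} \operatorname{Fix} U_i \neq \emptyset$. Let the sequence $\{x^k\}_{k=0}^{\infty}$ be defined by $$x^0\in\mathcal{H} \qquad \text{and} \qquad x^{k+1} := x^k+\lambda_k\sigma_k(x^k)\left(U_M\ldots U_1 x^{k}-x^k\right),\quad k=0,1,2,\ldots,$$ where $\lambda_k>0$ and $\sigma_k\colon\mathcal H \to [1,\infty)$. Assume that $\lambda_k \in[\underline \lambda, \overline \lambda]$ for some $\underline{\lambda} \in (0,1]$ and $\overline \lambda \in [1,1+\frac 1 M)$, and $\sigma_k(x)\in [1,\tau(x)]$ for each $x\in \mathcal H$, where $$\tau(x):=\frac{M}{M+1}\left( 1+\frac{\sum_{i=1}^M \left\|U_i\ldots U_1 x-U_{i-1}\ldots U_1 x\right\|^2}{\left\|U_M\ldots U_1 x-x\right\|^{2}}\right)\quad \text{if } x\notin C,$$ and $\tau(x):=1$ otherwise, with $U_{i-1}\ldots U_1x:=x$ for $i=1$. Set $r:=d(x^0,C)$ and $B:=B(P_Cx^0,r)$. Then the following statements hold: (i) If each $U_i$ is weakly regular over $B$, then $\{x^k\}_{k=0}^{\infty}$ converges weakly to some point $x^\infty\in C \cap B$. (ii) If each $U_i$ is regular over $B$ and the family $\{\operatorname{Fix} U_i \mid i\in I\}$ is regular over $B$, then the convergence to $x^\infty$ (a point of $C\cap B$) is in norm. (iii) If each $U_i$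 is $\delta_i$-linearly regular over $B$ and the family $\{\operatorname{Fix} U_i\mid i \in I\}$ is $\kappa$-linearly regular over $B$, then, with $x^\infty\in C\cap B$ the limit of $\{x^k\}_{k=0}^\infty$, for all $k=0,1,2,\ldots$ we have $$\frac{\delta}{2\kappa}\|x^k-x^\infty\|\leq \max_{i\in I}\|U_ix^k-x^k\|\leq \|x^k-x^\infty\|$$ and $$\|x^k - x^\infty\|\leq 2d(x^0,C)\left(\sqrt{1-\frac{\rho\delta^2}{M\kappa^2}\min\left\{ \frac 1 {\delta^2},\ \inf_k \Theta_k \right\} }\right)^{k},$$ where $\delta:= \min_{i\in I}\delta_i$, $\rho:=\frac 1 {M\overline{\lambda }} + \frac{1-\overline{\lambda}}{\overline{\lambda }}$ and $$\Theta_k := \lambda_k\sigma_k(x^k)\frac{1+M-M\lambda_k\frac{\sigma_k(x^k)}{\tau(x^k)}}{1+M-\frac{M}{\tau(x^k)}}.$$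
   Context: $\mathcal H$ is a real Hilbert space; $\operatorname{Fix} U$ is the fixed point set of $U$; $P_C$ is the metric projection onto a nonempty closed convex set $C$; $d(x,C)=\inf_{z\in C}\|x-z\|$; $B(z,r)$ is the closed ball with center $z$ and radius $r$. An operator $U\colon\mathcal H\to\mathcal H$ with $\operatorname{Fix}U\ne\emptyset$ is a cutter if $\langle z-Ux,x-Ux\rangle\le 0$ for all $x\in\mathcal H$ and $z\in\operatorname{Fix}U$ (its fixed point set is then closed and convex). Let $S\subseteq\mathcal H$ be nonempty and let $U\colon\mathcal H\to\mathcal H$ have a fixed point. $U$ is weakly regular over $S$ if for every sequence $\{x^k\}\subseteq S$ and $x^\infty\in\mathcal H$, $x^k\rightharpoonup x^\infty$ and $Ux^k-x^k\to0$ imply $x^\infty\in\operatorname{Fix}U$. $U$ is regular over $S$ if for every sequence $\{x^k\}\subseteq S$, $\|Ux^k-x^k\|\to0$ implies $d(x^k,\operatorname{Fix}U)\to0$. $U$ is $\delta_S$-linearly regular over $S$, where $\delta_S>0$, if $\delta_S\, d(x,\operatorname{Fix}U)\le\|Ux-x\|$ for all $x\in S$. A family $\{C_1,\ldots,C_M\}$ of closed convex sets with nonempty intersection $C=\bigcap_{i}C_i$ is regular over $S$ if for every sequence $\{x^k\}\subseteq S$, $\max_i d(x^k,C_i)\to0$ implies $d(x^k,C)\to0$; it is $\kappa$-linearly regular over $S$, where $\kappa>0$, if $d(x,C)\le\kappa\max_i d(x,C_i)$ for all $x\in S$. *)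

theory Defs
  imports "HOL-Analysis.Analysis"
begin

definition Fix :: "('a \<Rightarrow> 'a) \<Rightarrow> 'a set" where
  "Fix U = {x. U x = x}"

text \<open>A real Hilbert space is a type of sort \<open>{real_inner, complete_space}\<close>. Weak convergence
  is tested against the functionals \<open>\<lambda>x. x \<bullet> y\<close>, which by the Riesz theorem are all the bounded
  linear ones.\<close>

definition weakly_converges :: "(nat \<Rightarrow> 'a::real_inner) \<Rightarrow> 'a \<Rightarrow> bool" where
  "weakly_converges x l \<longleftrightarrow> (\<forall>y. (\<lambda>k. x k \<bullet> y) \<longlonglongrightarrow> l \<bullet> y)"

text \<open>Same description as \<^const>\<open>closest_point\<close>, whose type class \<open>heine_borel\<close> excludes
  infinite-dimensional spaces.\<close>

definition metric_projection :: "'a::metric_space set \<Rightarrow> 'a \<Rightarrow> 'a" where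
  "metric_projection C x = (SOME p. p \<in> C \<and> (\<forall>z\<in>C. dist x p \<le> dist x z))"

definition cutter :: "('a::real_inner \<Rightarrow> 'a) \<Rightarrow> bool" where
  "cutter U \<longleftrightarrow> Fix U \<noteq> {} \<and> (\<forall>x. \<forall>z\<in>Fix U. (z - U x) \<bullet> (x - U x) \<le> 0)"

text \<open>The regularity notions for an operator are meant for a nonempty set \<open>S\<close> and an operator with
  a fixed point, those for a family for closed convex sets with a common point and a finite nonempty
  index set; note that \<^term>\<open>infdist x {} = 0\<close>.\<close>

definition weakly_regular :: "('a::real_inner \<Rightarrow> 'a) \<Rightarrow> 'a set \<Rightarrow> bool" where
  "weakly_regular U S \<longleftrightarrow>
     (\<forall>x l. (\<forall>k. x k \<in> S) \<longrightarrow> weakly_converges x l \<longrightarrow> (\<lambda>k. U (x k) - x k) \<longlonglongrightarrow> 0 \<longrightarrow> l \<in> Fix U)"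

definition regular :: "('a::real_inner \<Rightarrow> 'a) \<Rightarrow> 'a set \<Rightarrow> bool" where
  "regular U S \<longleftrightarrow>
     (\<forall>x. (\<forall>k. x k \<in> S) \<longrightarrow> (\<lambda>k. norm (U (x k) - x k)) \<longlonglongrightarrow> 0 \<longrightarrow>
        (\<lambda>k. infdist (x k) (Fix U)) \<longlonglongrightarrow> 0)"

definition linearly_regular :: "real \<Rightarrow> ('a::real_inner \<Rightarrow> 'a) \<Rightarrow> 'a set \<Rightarrow> bool" where
  "linearly_regular \<delta> U S \<longleftrightarrow> \<delta> > 0 \<and> (\<forall>x\<in>S. \<delta> * infdist x (Fix U) \<le> norm (U x - x))"

definition family_regular :: "'i set \<Rightarrow> ('i \<Rightarrow> 'a::metric_space set) \<Rightarrow> 'a set \<Rightarrow> bool" where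
  "family_regular I C S \<longleftrightarrow>
     (\<forall>x. (\<forall>k. x k \<in> S) \<longrightarrow> (\<lambda>k::nat. MAX i\<in>I. infdist (x k) (C i)) \<longlonglongrightarrow> 0 \<longrightarrow>
        (\<lambda>k. infdist (x k) (\<Inter>i\<in>I. C i)) \<longlonglongrightarrow> 0)"

definition family_linearly_regular ::
    "real \<Rightarrow> 'i set \<Rightarrow> ('i \<Rightarrow> 'a::metric_space set) \<Rightarrow> 'a set \<Rightarrow> bool" where
  "family_linearly_regular \<kappa> I C S \<longleftrightarrow>
     \<kappa> > 0 \<and> (\<forall>x\<in>S. infdist x (\<Inter>i\<in>I. C i) \<le> \<kappa> * (MAX i\<in>I. infdist x (C i)))"

text \<open>\<open>partial_product U i x\<close> is $U_i \ldots U_1 x$; the operators are indexed from 1.\<close>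

primrec partial_product :: "(nat \<Rightarrow> 'a \<Rightarrow> 'a) \<Rightarrow> nat \<Rightarrow> 'a \<Rightarrow> 'a" where
  "partial_product U 0 x = x"
| "partial_product U (Suc i) x = U (Suc i) (partial_product U i x)"

definition extrapolation :: "nat \<Rightarrow> (nat \<Rightarrow> 'a::real_inner \<Rightarrow> 'a) \<Rightarrow> 'a \<Rightarrow> real" where
  "extrapolation M U x =
     (if x \<notin> (\<Inter>i\<in>{1..M}. Fix (U i)) then
        real M / (real M + 1) *
          (1 + (\<Sum>i=1..M. (norm (partial_product U i x - partial_product U (i - 1) x))\<^sup>2)
               / (norm (partial_product U M x - x))\<^sup>2)
      else 1)"

end

theory Submission
  imports Defs
begin

text \<open>
  Write \<open>T\<close> for the composition $U_M \ldots U_1$ and $S(x)$ for the sum of the squared lengths of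
  the \<open>M\<close> steps of the path $x, U_1 x, U_2 U_1 x, \ldots, T x$. Adding the cutter inequalities
  along this path gives, for every common fixed point \<open>z\<close>,
  $2 \langle z - x, T x - x \rangle \ge \|T x - x\|^2 + S(x)$
  (\<open>partial_product_displacement_inner_ge\<close>). Off the common fixed points the right-hand side is
  exactly $\frac{M+1}{M} \tau(x) \|T x - x\|^2$: the extrapolation bound \<open>\<tau>\<close> measures how much of the
  inequality is left over for steps longer than $T x - x$. Expanding $\|x^{k+1} - z\|^2$ therefore gives
  $\|x^{k+1} - z\|^2 \le \|x^k - z\|^2 - \Theta_k S(x^k)$ (\<open>extrapolated_step_decrease\<close>), and since
  $\overline\lambda < 1 + 1/M$, the factors $\Theta_k$ are bounded below by a positive constant.

  Three things follow: the iterates are Fejer monotone with respect to the set \<open>C\<close> of common fixed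
  points, all points of all the paths stay in the ball \<open>B\<close>, and $S(x^k) \to 0$, so that every single
  step of the paths vanishes in the limit and every $U_i \ldots U_1 x^k$ stays asymptotically close to
  $x^k$. The regularity assumptions turn this into the three claims.

  \<^item> If the operators are weakly regular, a weak cluster point of the iterates is also a weak cluster
    point of each sequence $U_{i-1} \ldots U_1 x^k$, hence fixed by each $U_i$. A Fejer monotone
    sequence all of whose weak cluster points lie in \<open>C\<close> converges weakly
    (\<open>Fejer_monotone_weakly_convergent\<close>).
  \<^item> If the operators and the family of fixed point sets are regular, the distances from the iterates
    to the sets $\mathrm{Fix}\, U_i$, and then to \<open>C\<close>, tend to zero. By Fejer monotonicity
    $\|x^m - x^k\| \le 2 d(x^k, C)$ for $m \ge k$, so the sequence is Cauchy.
  \<^item> If the regularity is linear with $\delta \le 1$, the distance from \<open>x\<close> to $\mathrm{Fix}\, U_j$ is at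
    most $\delta^{-1}$ times the length of the path from \<open>x\<close>, so $\delta^2 d(x, \mathrm{Fix}\, U_j)^2 \le M S(x)$
    (\<open>infdist_Fix_squared_le\<close>), and $d(x, C)^2$ is at most $\kappa^2$ times the largest of these
    distances squared. The decrease $\Theta_k S(x^k)$ is then a fixed proportion of $d(x^k, C)^2$, and
    the distance to \<open>C\<close> shrinks geometrically (\<open>infdist_contraction\<close>).

  The Hilbert space facts behind this, the metric projection onto a closed convex set and the weak
  sequential compactness of bounded sets, both rest on the nonemptiness of nested intersections of
  bounded closed convex sets.
\<close>

section \<open>Closed convex sets and weak limits in a Hilbert space\<close>

text \<open>Almost norm-minimal points of the sets form a Cauchy sequence. For \<open>n \<le> k\<close> the midpoint of the
\<open>n\<close>-th and the \<open>k\<close>-th of them lies in \<open>K n\<close>, so it is not much shorter than the two points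
themselves, and the parallelogram law then forces the two points to be close.\<close>

lemma nested_closed_convex_bounded_Inter_nonempty:
  fixes K :: "nat \<Rightarrow> 'a::{real_inner, complete_space} set"
  assumes closed: "\<And>n. closed (K n)" and convex: "\<And>n. convex (K n)"
    and nonempty: "\<And>n. K n \<noteq> {}" and dec: "decseq K" and bounded: "bounded (K 0)"
  shows "(\<Inter>n. K n) \<noteq> {}"
proof -
  define m where "m n = infdist 0 (K n)" for n
  have sub: "K k \<subseteq> K n" if "n \<le> k" for n k
    using dec that by (simp add: decseq_def)
  have m_mono: "incseq m"
    unfolding m_def using sub nonempty by (intro incseq_SucI infdist_mono) auto
  obtain R where R: "\<And>v. v \<in> K 0 \<Longrightarrow> norm v \<le> R"
    using bounded by (auto simp: bounded_iff)
  have "m n \<le> R" for n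
  proof -
    obtain v where "v \<in> K n" using nonempty by blast
    moreover from this have "v \<in> K 0" using sub[of 0 n] by auto
    ultimately show ?thesis
      unfolding m_def using R[of v] by (intro infdist_le2[of v]) auto
  qed
  then obtain L where mL: "m \<longlonglongrightarrow> L"
    using incseq_convergent[OF m_mono] by blast
  have "\<exists>v\<in>K n. norm v < m n + 1 / (real n + 1)" for n
  proof -
    have "(INF v\<in>K n. dist 0 v) < m n + 1 / (real n + 1)"
      using infdist_notempty[OF nonempty[of n], of 0] by (simp add: m_def)
    then show ?thesis
      using nonempty[of n] by (subst (asm) cINF_less_iff) (auto intro!: bdd_belowI2[of _ 0])
  qed
  then obtain a where a: "\<And>n. a n \<in> K n" "\<And>n. norm (a n) < m n + 1 / (real n + 1)"
    by metis
  have m_le: "m n \<le> norm v" if "v \<in> K n" for n v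
    using infdist_le[OF that, of 0] by (simp add: m_def)
  have aL: "(\<lambda>n. norm (a n)) \<longlonglongrightarrow> L"
  proof (rule tendsto_sandwich[OF _ _ mL])
    have "(\<lambda>n. m n + 1 / (real n + 1)) \<longlonglongrightarrow> L + 0"
      using mL LIMSEQ_inverse_real_of_nat by (intro tendsto_add) (simp_all add: inverse_eq_divide add.commute)
    then show "(\<lambda>n. m n + 1 / (real n + 1)) \<longlonglongrightarrow> L" by simp
  qed (use m_le a in \<open>auto intro!: always_eventually simp: less_imp_le\<close>)
  have parallelogram: "(norm (a n - a k))\<^sup>2 \<le> 2 * (norm (a n))\<^sup>2 + 2 * (norm (a k))\<^sup>2 - 4 * (m n)\<^sup>2"
    if "n \<le> k" for n k
  proof -
    have "(1/2) *\<^sub>R a n + (1/2) *\<^sub>R a k \<in> K n"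
      using a(1) sub[OF that] by (intro convexD[OF convex]) auto
    then have "m n \<le> norm ((1/2) *\<^sub>R (a n + a k))"
      using m_le by (simp add: scaleR_add_right)
    then have "2 * m n \<le> norm (a n + a k)" by simp
    then have "(2 * m n)\<^sup>2 \<le> (norm (a n + a k))\<^sup>2"
      by (intro power_mono) (auto simp: m_def infdist_nonneg)
    moreover have "(norm (a n - a k))\<^sup>2 + (norm (a n + a k))\<^sup>2 = 2 * (norm (a n))\<^sup>2 + 2 * (norm (a k))\<^sup>2"
      by (simp add: power2_norm_eq_inner inner_diff inner_add algebra_simps)
    ultimately show ?thesis by (simp add: power_mult_distrib)
  qed
  have "Cauchy a"
  proof (rule metric_CauchyI)
    fix e :: real assume "e > 0"
    then have e: "e\<^sup>2 / 8 > 0" by simp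
    have "(\<lambda>n. (norm (a n))\<^sup>2) \<longlonglongrightarrow> L\<^sup>2" "(\<lambda>n. (m n)\<^sup>2) \<longlonglongrightarrow> L\<^sup>2"
      using aL mL by (auto intro: tendsto_power)
    with e have "eventually (\<lambda>n. dist ((norm (a n))\<^sup>2) (L\<^sup>2) < e\<^sup>2 / 8 \<and> dist ((m n)\<^sup>2) (L\<^sup>2) < e\<^sup>2 / 8) sequentially"
      by (intro eventually_conj tendstoD)
    then obtain N where N: "\<And>n. n \<ge> N \<Longrightarrow> \<bar>(norm (a n))\<^sup>2 - L\<^sup>2\<bar> < e\<^sup>2 / 8"
        "\<And>n. n \<ge> N \<Longrightarrow> \<bar>(m n)\<^sup>2 - L\<^sup>2\<bar> < e\<^sup>2 / 8"
      by (auto simp: eventually_sequentially dist_real_def)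
    have "dist (a n) (a k) < e" if "N \<le> n" "n \<le> k" for n k
    proof -
      have "N \<le> k" using that by simp
      have "(norm (a n - a k))\<^sup>2 < e\<^sup>2"
        using parallelogram[OF that(2)] N[OF that(1)] N(1)[OF \<open>N \<le> k\<close>] by linarith
      then show ?thesis
        using \<open>e > 0\<close> by (simp add: dist_norm power2_less_imp_less)
    qed
    then have "\<forall>n\<ge>N. \<forall>k\<ge>N. dist (a n) (a k) < e"
      by (metis dist_commute nle_le)
    then show "\<exists>N. \<forall>n\<ge>N. \<forall>k\<ge>N. dist (a n) (a k) < e" by blast
  qed
  then obtain l where l: "a \<longlonglongrightarrow> l"
    by (auto simp: Cauchy_convergent_iff convergent_def)
  have "l \<in> K n" for n
  proof (rule closed_sequentially[OF closed])
    show "a (k + n) \<in> K n" for k using a(1) sub[of n "k + n"] by auto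
    show "(\<lambda>k. a (k + n)) \<longlonglongrightarrow> l" using l by (rule LIMSEQ_ignore_initial_segment)
  qed
  then show ?thesis by blast
qed

text \<open>A nearest point is a point common to the nested sets of those \<open>z \<in> C\<close> whose distance to \<open>v\<close> exceeds
the infimum by at most \<open>1 / (n + 1)\<close>.\<close>

lemma metric_projection_closed_convex:
  fixes C :: "'a::{real_inner, complete_space} set"
  assumes "closed C" "convex C" "C \<noteq> {}"
  shows "metric_projection C v \<in> C" and "dist v (metric_projection C v) = infdist v C"
    and "z \<in> C \<Longrightarrow> dist v (metric_projection C v) \<le> dist v z"
proof -
  define K where "K n = C \<inter> cball v (infdist v C + 1 / (real n + 1))" for n :: nat
  have "K n \<noteq> {}" for n
  proof -
    have "(INF z\<in>C. dist v z) < infdist v C + 1 / (real n + 1)"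
      using infdist_notempty[OF assms(3), of v] by simp
    then obtain z where "z \<in> C" "dist v z < infdist v C + 1 / (real n + 1)"
      by (subst (asm) cINF_less_iff) (auto simp: assms)
    then show ?thesis by (auto simp: K_def intro!: exI[of _ z])
  qed
  moreover have "decseq K"
    unfolding K_def by (intro decseq_SucI Int_mono order_refl subset_cball) (simp add: frac_le)
  moreover have "closed (K n)" "convex (K n)" "bounded (K n)" for n
    using assms by (auto simp: K_def intro!: closed_Int convex_Int bounded_Int)
  ultimately have "(\<Inter>n. K n) \<noteq> {}"
    by (intro nested_closed_convex_bounded_Inter_nonempty)
  then obtain p where "\<And>n. p \<in> K n" by blast
  then have p: "p \<in> C" "\<And>n. dist v p \<le> infdist v C + 1 / (real n + 1)"
    unfolding K_def by auto
  have "(\<lambda>n. infdist v C + 1 / (real n + 1)) \<longlonglongrightarrow> infdist v C + 0"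
    using LIMSEQ_inverse_real_of_nat by (intro tendsto_add) (simp_all add: inverse_eq_divide add.commute)
  then have "dist v p \<le> infdist v C"
    using p(2) by (intro LIMSEQ_le_const) auto
  then have "\<exists>p. p \<in> C \<and> (\<forall>z\<in>C. dist v p \<le> dist v z)"
    using p(1) infdist_le order_trans by blast
  then have *: "metric_projection C v \<in> C \<and> (\<forall>z\<in>C. dist v (metric_projection C v) \<le> dist v z)"
    unfolding metric_projection_def by (rule someI_ex)
  then show "metric_projection C v \<in> C" "z \<in> C \<Longrightarrow> dist v (metric_projection C v) \<le> dist v z"
    by auto
  show "dist v (metric_projection C v) = infdist v C"
  proof (rule antisym)
    show "dist v (metric_projection C v) \<le> infdist v C"
      using * assms by (subst infdist_notempty) (auto intro!: cINF_greatest)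
  qed (use * in \<open>auto intro: infdist_le\<close>)
qed

text \<open>A subsequence can be chosen such that its inner products with every member of the original sequence
converge, by compactness of a countable product of intervals. A candidate \<open>l\<close> for the weak limit is
any point common to the closed convex hulls of its tails: \<open>l\<close> inherits every bound on a linear
functional that eventually holds along the subsequence, so testing against members of the
sequence gives the right limits. The vectors \<open>y\<close> against which the subsequence converges weakly to \<open>l\<close>
form a closed subspace \<open>W\<close>. It contains the whole sequence and \<open>l\<close>, and therefore also every vector
orthogonal to it, so it is the whole space.\<close>

lemma bounded_weakly_convergent_subsequence:
  fixes x :: "nat \<Rightarrow> 'a::{real_inner, complete_space}"
  assumes "bounded (range x)"
  obtains r l where "strict_mono (r :: nat \<Rightarrow> nat)" "weakly_converges (x \<circ> r) l"
proof -
  obtain R where R: "\<And>k. norm (x k) \<le> R"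
    using assms by (auto simp: bounded_iff)
  define K where "K = PiE (UNIV :: nat set) (\<lambda>_. cball (0::real) (R * R))"
  have "compact K"
    using compactin_PiE[of "\<lambda>_. euclidean" UNIV "\<lambda>_. cball (0::real) (R * R)"]
    by (simp add: K_def euclidean_product_topology)
  moreover have "(\<lambda>m. x k \<bullet> x m) \<in> K" for k
  proof -
    have "\<bar>x k \<bullet> x m\<bar> \<le> R * R" for m
      by (rule order_trans[OF Cauchy_Schwarz_ineq2 mult_mono])
         (use R norm_ge_zero order_trans in blast)+
    then show ?thesis by (auto simp: K_def)
  qed
  ultimately have "\<exists>g\<in>K. \<exists>r::nat \<Rightarrow> nat. strict_mono r \<and> ((\<lambda>k. \<lambda>m. x k \<bullet> x m) \<circ> r) \<longlonglongrightarrow> g"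
    using compact_imp_seq_compact[of K, unfolded seq_compact_def, rule_format, of "\<lambda>k m. x k \<bullet> x m"] by simp
  then obtain g r where r: "strict_mono (r :: nat \<Rightarrow> nat)"
      and "((\<lambda>k. \<lambda>m. x k \<bullet> x m) \<circ> r) \<longlonglongrightarrow> g"
    by blast
  then have g: "(\<lambda>k. x (r k) \<bullet> x m) \<longlonglongrightarrow> g m" for m
    by (auto simp: o_def dest: continuous_on_tendsto_compose[OF continuous_on_product_coordinates[of m], where F=sequentially])

  define T where "T n = closure (convex hull (\<lambda>j. x (r j)) ` {n..})" for n
  have "(\<Inter>n. T n) \<noteq> {}"
  proof (rule nested_closed_convex_bounded_Inter_nonempty)
    show "decseq T"
      unfolding T_def by (intro decseq_SucI closure_mono hull_mono image_mono) auto
    show "bounded (T 0)"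
      unfolding T_def using assms
      by (intro bounded_closure bounded_convex_hull) (auto intro: bounded_subset)
  qed (auto simp: T_def)
  then obtain l where l: "\<And>n. l \<in> T n" by blast
  have T_sub: "l \<in> A" if "closed A" "convex A" "\<And>j. j \<ge> n \<Longrightarrow> x (r j) \<in> A" for A n
  proof -
    have "T n \<subseteq> A"
      unfolding T_def using that by (intro closure_minimal hull_minimal) auto
    then show ?thesis using l by blast
  qed
  \<comment> \<open>The good test vectors; the orthogonal decomposition along \<open>W\<close> reduces all others to them.\<close>
  define W where "W = {y. (\<lambda>j. (x (r j) - l) \<bullet> y) \<longlonglongrightarrow> 0}"
  have sub: "subspace W"
    unfolding W_def subspace_def
    by (auto simp: inner_add_right intro: tendsto_add_zero tendsto_mult_right_zero)
  have norm_l: "norm l \<le> R"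
    using T_sub[of "cball 0 R" 0] R by auto
  have D: "norm (x (r j) - l) \<le> 2 * R + 1" for j
    using norm_triangle_ineq4[of "x (r j)" l] R[of "r j"] norm_l by linarith
  have R0: "2 * R + 1 > 0"
    using norm_l norm_ge_zero[of l] by linarith
  have "closed W"
    unfolding closed_sequential_limits
  proof (intro allI impI, elim conjE)
    fix y w assume yW: "\<forall>n. y n \<in> W" and yw: "y \<longlonglongrightarrow> w"
    have "(\<lambda>j. (x (r j) - l) \<bullet> w) \<longlonglongrightarrow> 0"
    proof (rule LIMSEQ_I)
      fix e :: real assume "e > 0"
      then have "e / (2 * (2 * R + 1)) > 0" using R0 by simp
      then obtain n where n: "norm (y n - w) < e / (2 * (2 * R + 1))"
        using yw LIMSEQ_D by blast
      obtain J where J: "\<And>j. j \<ge> J \<Longrightarrow> \<bar>(x (r j) - l) \<bullet> y n\<bar> < e / 2"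
        using yW[rule_format, of n] \<open>e > 0\<close> LIMSEQ_D[of "\<lambda>j. (x (r j) - l) \<bullet> y n" 0 "e / 2"]
        by (auto simp: W_def)
      have "\<bar>(x (r j) - l) \<bullet> w\<bar> < e" if "j \<ge> J" for j
      proof -
        have "\<bar>(x (r j) - l) \<bullet> (w - y n)\<bar> \<le> (2 * R + 1) * norm (w - y n)"
          by (rule order_trans[OF Cauchy_Schwarz_ineq2 mult_right_mono]) (use D in auto)
        also have "\<dots> < e / 2"
          using n R0 by (simp add: norm_minus_commute field_simps)
        finally show ?thesis
          using J[OF that] unfolding inner_diff_right by arith
      qed
      then show "\<exists>J. \<forall>j\<ge>J. norm ((x (r j) - l) \<bullet> w - 0) < e" by auto
    qed
    then show "w \<in> W" by (simp add: W_def)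
  qed
  have l_inner: "l \<bullet> x m = g m" for m
  proof -
    have "\<bar>l \<bullet> x m - g m\<bar> \<le> e" if e: "e > 0" for e
    proof -
      obtain n where "\<And>j. j \<ge> n \<Longrightarrow> \<bar>x (r j) \<bullet> x m - g m\<bar> < e"
        using LIMSEQ_D[OF g e, of m] by auto
      then have "l \<in> {v. x m \<bullet> v \<le> g m + e} \<inter> {v. x m \<bullet> v \<ge> g m - e}"
        by (intro T_sub[of _ n] closed_Int convex_Int closed_halfspace_le closed_halfspace_ge
            convex_halfspace_le convex_halfspace_ge) (fastforce simp: abs_less_iff inner_commute)
      then show ?thesis by (auto simp: inner_commute)
    qed
    then show ?thesis using field_le_epsilon[of "\<bar>l \<bullet> x m - g m\<bar>" 0] by simp
  qed
  have xW: "x m \<in> W" for m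
    using tendsto_diff[OF g tendsto_const[of "l \<bullet> x m"], of m]
    by (simp add: W_def inner_diff_left l_inner)
  have lW: "l \<in> W"
    using T_sub[OF \<open>closed W\<close> subspace_imp_convex[OF sub] xW] .
  have "(\<lambda>j. (x (r j) - l) \<bullet> y) \<longlonglongrightarrow> 0" for y
  proof -
    define p where "p = metric_projection W y"
    have p: "p \<in> W" "\<forall>z\<in>W. dist y p \<le> dist y z"
      using metric_projection_closed_convex(1,3)[OF \<open>closed W\<close> subspace_imp_convex[OF sub]] lW
      unfolding p_def by blast+
    have "(y - p) \<bullet> w = 0" if "w \<in> W" for w
    proof -
      have "p + w \<in> W" "p - w \<in> W"
        using subspace_add[OF sub] subspace_diff[OF sub] p(1) that by auto
      note this[THEN any_closest_point_dot[OF subspace_imp_convex[OF sub] \<open>closed W\<close> p(1) _ p(2)]]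
      then show ?thesis by simp
    qed
    then have "(y - p) \<bullet> (x (r j) - l) = 0" for j
      using xW lW by (simp add: subspace_diff[OF sub])
    then have "(x (r j) - l) \<bullet> y = (x (r j) - l) \<bullet> p" for j
      by (simp add: inner_commute inner_diff_left)
    then show ?thesis using p(1) by (simp add: W_def)
  qed
  then have "weakly_converges (x \<circ> r) l"
    unfolding weakly_converges_def using LIM_zero_iff[of "\<lambda>j. x (r j) \<bullet> _"]
    by (auto simp: inner_diff_left LIM_zero_iff)
  with r show ?thesis using that by blast
qed

lemma weak_limit_in_closed_halfspace:
  assumes "weakly_converges x l" "\<And>k. x k \<bullet> a \<le> b"
  shows "l \<bullet> a \<le> b"
  using assms LIMSEQ_le_const2 unfolding weakly_converges_def by blast

lemma weak_limit_in_cball: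
  assumes "weakly_converges x l" "\<And>k. x k \<in> cball c R"
  shows "l \<in> cball c R"
proof (cases "l = c")
  case False
  have "(x k - c) \<bullet> (l - c) \<le> R * norm (l - c)" for k
  proof -
    have "(x k - c) \<bullet> (l - c) \<le> norm (x k - c) * norm (l - c)"
      by (rule norm_cauchy_schwarz)
    also have "\<dots> \<le> R * norm (l - c)"
      using assms(2)[of k] by (intro mult_right_mono) (auto simp: dist_norm norm_minus_commute)
    finally show ?thesis .
  qed
  then have "l \<bullet> (l - c) \<le> R * norm (l - c) + c \<bullet> (l - c)"
    by (intro weak_limit_in_closed_halfspace[OF assms(1)]) (use \<open>\<And>k. (x k - c) \<bullet> (l - c) \<le> _\<close> in \<open>simp add: inner_diff_left algebra_simps\<close>)
  then have "norm (l - c) * norm (l - c) \<le> R * norm (l - c)"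
    by (simp add: norm_eq_square inner_diff_left flip: power2_eq_square power2_norm_eq_inner)
      (simp add: power2_norm_eq_inner inner_diff_left)
  then show ?thesis using False by (simp add: dist_norm norm_minus_commute)
qed (use assms(2)[of 0] in \<open>auto intro: order_trans[OF zero_le_dist]\<close>)

lemma weakly_converges_add_null:
  assumes "weakly_converges x l" "(\<lambda>k. y k - x k) \<longlonglongrightarrow> 0"
  shows "weakly_converges y l"
  unfolding weakly_converges_def
proof
  fix v
  have "(\<lambda>k. x k \<bullet> v + (y k - x k) \<bullet> v) \<longlonglongrightarrow> l \<bullet> v + 0 \<bullet> v"
    using assms(1) by (intro tendsto_add tendsto_inner[OF assms(2) tendsto_const]) (simp add: weakly_converges_def)
  then show "(\<lambda>k. y k \<bullet> v) \<longlonglongrightarrow> l \<bullet> v" by (simp add: inner_diff_left)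
qed

section \<open>Fejer monotone sequences\<close>

definition Fejer_monotone :: "'a::real_normed_vector set \<Rightarrow> (nat \<Rightarrow> 'a) \<Rightarrow> bool" where
  "Fejer_monotone C x \<longleftrightarrow> (\<forall>z\<in>C. \<forall>k. norm (x (Suc k) - z) \<le> norm (x k - z))"

lemma Fejer_monotone_decseq:
  "Fejer_monotone C x \<Longrightarrow> z \<in> C \<Longrightarrow> decseq (\<lambda>k. norm (x k - z))"
  by (intro decseq_SucI) (simp add: Fejer_monotone_def)

lemma Fejer_monotone_in_cball:
  assumes "Fejer_monotone C x" "p \<in> C"
  shows "x k \<in> cball p (dist (x 0) p)"
  using decseqD[OF Fejer_monotone_decseq[OF assms], of 0 k] by (simp add: dist_norm norm_minus_commute)

text \<open>Take a point of \<open>C\<close> almost nearest to \<open>x k\<close>; by monotonicity \<open>x m\<close> is no farther from it than \<open>x k\<close>.\<close>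

lemma Fejer_monotone_dist_le:
  assumes "Fejer_monotone C x" "C \<noteq> {}" "k \<le> m"
  shows "dist (x m) (x k) \<le> 2 * infdist (x k) C"
proof (rule field_le_epsilon)
  fix e :: real assume "e > 0"
  then have "(INF z\<in>C. dist (x k) z) < infdist (x k) C + e / 2"
    using infdist_notempty[OF assms(2), of "x k"] by simp
  then obtain z where z: "z \<in> C" "dist (x k) z < infdist (x k) C + e / 2"
    by (subst (asm) cINF_less_iff) (auto simp: assms)
  have "dist (x m) z \<le> dist (x k) z"
    using decseqD[OF Fejer_monotone_decseq[OF assms(1) z(1)] assms(3)] by (simp add: dist_norm)
  then show "dist (x m) (x k) \<le> 2 * infdist (x k) C + e"
    using dist_triangle2[of "x m" "x k" z] z(2) by linarith
qed

lemma Fejer_monotone_dist_limit_le: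
  assumes "Fejer_monotone C x" "C \<noteq> {}" "x \<longlonglongrightarrow> l"
  shows "dist (x k) l \<le> 2 * infdist (x k) C"
proof (rule Lim_bounded)
  show "(\<lambda>m. dist (x k) (x m)) \<longlonglongrightarrow> dist (x k) l"
    using assms(3) by (intro tendsto_intros)
  show "\<forall>m\<ge>k. dist (x k) (x m) \<le> 2 * infdist (x k) C"
    using Fejer_monotone_dist_le[OF assms(1,2)] by (auto simp: dist_commute[of "x k"])
qed

lemma Fejer_monotone_convergent:
  fixes x :: "nat \<Rightarrow> 'a::{real_normed_vector, complete_space}"
  assumes "Fejer_monotone C x" "C \<noteq> {}" "closed C" "(\<lambda>k. infdist (x k) C) \<longlonglongrightarrow> 0"
  obtains l where "l \<in> C" "x \<longlonglongrightarrow> l"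
proof -
  have "Cauchy x"
  proof (rule metric_CauchyI)
    fix e :: real assume "e > 0"
    then obtain N where "\<forall>n\<ge>N. norm (infdist (x n) C - 0) < e / 4"
      using LIMSEQ_D[OF assms(4), of "e / 4"] by auto
    then have N: "infdist (x N) C < e / 4" by (auto simp: infdist_nonneg)
    have "dist (x m) (x N) < e / 2" if "m \<ge> N" for m
      using Fejer_monotone_dist_le[OF assms(1,2) that] N by linarith
    then have "dist (x m) (x n) < e" if "m \<ge> N" "n \<ge> N" for m n
      using that by (meson dist_triangle_half_l)
    then show "\<exists>N. \<forall>m\<ge>N. \<forall>n\<ge>N. dist (x m) (x n) < e" by blast
  qed
  then obtain l where l: "x \<longlonglongrightarrow> l" by (auto simp: Cauchy_convergent_iff convergent_def)
  then have "(\<lambda>k. infdist (x k) C) \<longlonglongrightarrow> infdist l C" by (rule tendsto_infdist)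
  with assms(4) have "infdist l C = 0" by (rule LIMSEQ_unique[symmetric])
  then have "l \<in> C" using assms in_closed_iff_infdist_zero by blast
  with l that show ?thesis by blast
qed

text \<open>The argument of Opial. For two cluster points \<open>l\<close> and \<open>l'\<close> in \<open>C\<close> the distances to \<open>l\<close> and to \<open>l'\<close>
converge by monotonicity, so the difference of their squares does, and hence so do the inner products
of the iterates with \<open>l - l'\<close>. Their limit is both \<open>l \<bullet> (l - l')\<close> and \<open>l' \<bullet> (l - l')\<close>, which makes the
two cluster points equal. A bounded sequence with a single weak cluster point converges weakly.\<close>

lemma Fejer_monotone_weakly_convergent:
  fixes x :: "nat \<Rightarrow> 'a::{real_inner, complete_space}"
  assumes Fejer: "Fejer_monotone C x" and "C \<noteq> {}"
    and cluster: "\<And>r l. strict_mono (r :: nat \<Rightarrow> nat) \<Longrightarrow> weakly_converges (x \<circ> r) l \<Longrightarrow> l \<in> C"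
  obtains l where "l \<in> C" "weakly_converges x l"
proof -
  obtain p where "p \<in> C" using \<open>C \<noteq> {}\<close> by blast
  then have bounded: "bounded (range (x \<circ> r))" for r :: "nat \<Rightarrow> nat"
    using Fejer_monotone_in_cball[OF Fejer] by (intro bounded_subset[OF bounded_cball]) auto
  have unique: "l = l'" if "strict_mono r" "weakly_converges (x \<circ> r) l"
      "strict_mono r'" "weakly_converges (x \<circ> r') l'" for r r' :: "nat \<Rightarrow> nat" and l l'
  proof -
    have conv: "convergent (\<lambda>k. (norm (x k - z))\<^sup>2)" if z: "z \<in> C" for z
    proof -
      obtain c where "(\<lambda>k. norm (x k - z)) \<longlonglongrightarrow> c"
        using decseq_convergent[OF Fejer_monotone_decseq[OF Fejer z], of 0] norm_ge_zero by blast
      then show ?thesis using tendsto_power convergent_def by blast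
    qed
    have "l \<in> C" "l' \<in> C" using cluster that by auto
    then have "convergent (\<lambda>k. (norm (x k - l'))\<^sup>2 - (norm (x k - l))\<^sup>2)"
      by (intro convergent_diff conv)
    then obtain c where "(\<lambda>k. (norm (x k - l'))\<^sup>2 - (norm (x k - l))\<^sup>2) \<longlonglongrightarrow> c"
      by (auto simp: convergent_def)
    then have "(\<lambda>k. ((norm (x k - l'))\<^sup>2 - (norm (x k - l))\<^sup>2 - l' \<bullet> l' + l \<bullet> l) / 2)
                 \<longlonglongrightarrow> (c - l' \<bullet> l' + l \<bullet> l) / 2"
      by (intro tendsto_intros) auto
    moreover have "((norm (x k - l'))\<^sup>2 - (norm (x k - l))\<^sup>2 - l' \<bullet> l' + l \<bullet> l) / 2 = x k \<bullet> (l - l')" for k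
      by (simp add: power2_norm_eq_inner inner_diff inner_commute field_simps)
    ultimately obtain d where d: "(\<lambda>k. x k \<bullet> (l - l')) \<longlonglongrightarrow> d" by auto
    have "l \<bullet> (l - l') = d"
      using LIMSEQ_unique[OF _ LIMSEQ_subseq_LIMSEQ[OF d that(1)]] that(2)
      by (simp add: weakly_converges_def o_def)
    moreover have "l' \<bullet> (l - l') = d"
      using LIMSEQ_unique[OF _ LIMSEQ_subseq_LIMSEQ[OF d that(3)]] that(4)
      by (simp add: weakly_converges_def o_def)
    ultimately have "(l - l') \<bullet> (l - l') = 0" by (simp add: inner_diff_left)
    then show ?thesis by simp
  qed
  obtain r l where r: "strict_mono (r :: nat \<Rightarrow> nat)" and l: "weakly_converges (x \<circ> r) l"
    using bounded_weakly_convergent_subsequence[OF bounded[of id]] by (auto simp: o_def)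
  \<comment> \<open>Along a subsequence that stays away from the limit there would be a second cluster point.\<close>
  have "(\<lambda>k. x k \<bullet> y) \<longlonglongrightarrow> l \<bullet> y" for y
  proof (rule ccontr)
    assume "\<not> ?thesis"
    then obtain e where "e > 0" and e: "\<And>N. \<exists>k\<ge>N. dist (x k \<bullet> y) (l \<bullet> y) \<ge> e"
      unfolding lim_sequentially by (meson not_less)
    then have "infinite {k. dist (x k \<bullet> y) (l \<bullet> y) \<ge> e}"
      unfolding infinite_nat_iff_unbounded_le by auto
    then obtain s where s: "strict_mono (s :: nat \<Rightarrow> nat)" "\<And>k. dist (x (s k) \<bullet> y) (l \<bullet> y) \<ge> e"
      using infinite_enumerate by blast
    obtain t l' where t: "strict_mono (t :: nat \<Rightarrow> nat)" "weakly_converges ((x \<circ> s) \<circ> t) l'"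
      using bounded_weakly_convergent_subsequence[OF bounded] by blast
    then have "l' = l"
      using unique[OF strict_mono_o[OF s(1) t(1)] _ r l] by (simp add: o_assoc)
    then have "(\<lambda>k. dist (x (s (t k)) \<bullet> y) (l \<bullet> y)) \<longlonglongrightarrow> 0"
      using t(2) by (simp add: weakly_converges_def o_def tendsto_dist_iff[symmetric])
    then have "e \<le> 0" using s(2) by (intro LIMSEQ_le_const) auto
    with \<open>e > 0\<close> show False by simp
  qed
  then have "weakly_converges x l" by (simp add: weakly_converges_def)
  with cluster[OF r l] that show ?thesis by blast
qed

section \<open>Cutters\<close>

lemma cutter_inner_le:
  "cutter U \<Longrightarrow> z \<in> Fix U \<Longrightarrow> (z - U x) \<bullet> (x - U x) \<le> 0"
  by (simp add: cutter_def)

lemma cutter_displacement_le: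
  assumes "cutter U" "z \<in> Fix U"
  shows "norm (U x - x) \<le> norm (x - z)"
proof (cases "U x = x")
  case False
  have "norm (x - U x) * norm (x - U x) = (x - z) \<bullet> (x - U x) + (z - U x) \<bullet> (x - U x)"
    unfolding power2_eq_square[symmetric] power2_norm_eq_inner by (simp add: inner_diff_left)
  also have "\<dots> \<le> norm (x - z) * norm (x - U x)"
    using cutter_inner_le[OF assms, of x] norm_cauchy_schwarz[of "x - z" "x - U x"] by linarith
  finally show ?thesis using False by (simp add: norm_minus_commute)
qed simp

lemma cutter_displacement_le_infdist:
  assumes "cutter U"
  shows "norm (U x - x) \<le> infdist x (Fix U)"
proof -
  have "Fix U \<noteq> {}" using assms by (simp add: cutter_def)
  then show ?thesis
    unfolding infdist_notempty[OF \<open>Fix U \<noteq> {}\<close>] dist_norm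
    by (intro cINF_greatest cutter_displacement_le[OF assms])
qed

lemma cutter_quasi_nonexpansive:
  assumes "cutter U" "z \<in> Fix U"
  shows "norm (U x - z) \<le> norm (x - z)"
proof -
  have "(norm (x - z))\<^sup>2 = (norm (x - U x))\<^sup>2 + (norm (U x - z))\<^sup>2 - 2 * ((z - U x) \<bullet> (x - U x))"
    unfolding power2_norm_eq_inner
    by (simp add: inner_diff_left inner_diff_right inner_commute)
  then have "(norm (U x - z))\<^sup>2 \<le> (norm (x - z))\<^sup>2"
    using cutter_inner_le[OF assms, of x] zero_le_power2[of "norm (x - U x)"] by linarith
  then show ?thesis by (rule power2_le_imp_le) simp
qed

text \<open>Each inequality in the definition of a cutter puts the fixed points into a closed half-space, and the
half-space belonging to \<open>x = z\<close> contains \<open>z\<close> only if \<open>z\<close> is fixed.\<close>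

lemma cutter_Fix_eq_Inter_halfspaces:
  assumes "cutter U"
  shows "Fix U = (\<Inter>x. {z. (x - U x) \<bullet> z \<le> (x - U x) \<bullet> U x})"
proof (intro equalityI subsetI)
  fix z assume "z \<in> Fix U"
  then have "(x - U x) \<bullet> z \<le> (x - U x) \<bullet> U x" for x
    using cutter_inner_le[OF assms, of z x]
    unfolding inner_commute[of "z - U x"] inner_diff_right[of _ z] by simp
  then show "z \<in> (\<Inter>x. {z. (x - U x) \<bullet> z \<le> (x - U x) \<bullet> U x})" by blast
next
  fix z assume "z \<in> (\<Inter>x. {z. (x - U x) \<bullet> z \<le> (x - U x) \<bullet> U x})"
  then have "(z - U z) \<bullet> (z - U z) \<le> 0" by (simp add: inner_diff_right)
  then have "(z - U z) \<bullet> (z - U z) = 0" by (rule antisym[OF _ inner_ge_zero])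
  then show "z \<in> Fix U" by (simp add: Fix_def)
qed

lemma cutter_Fix_closed_convex:
  assumes "cutter U"
  shows "closed (Fix U)" "convex (Fix U)"
  unfolding cutter_Fix_eq_Inter_halfspaces[OF assms]
  by (auto intro!: closed_INT closed_halfspace_le convex_INT convex_halfspace_le)

section \<open>Compositions of cutters and the extrapolated step\<close>

definition squared_steps :: "nat \<Rightarrow> (nat \<Rightarrow> 'a::real_inner \<Rightarrow> 'a) \<Rightarrow> 'a \<Rightarrow> real" where
  "squared_steps M U y = (\<Sum>i=1..M. (norm (partial_product U i y - partial_product U (i - 1) y))\<^sup>2)"

lemma squared_steps_nonneg: "0 \<le> squared_steps M U y"
  by (simp add: squared_steps_def sum_nonneg)

lemma step_squared_le_squared_steps:
  assumes "i \<in> {1..M}"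
  shows "(norm (partial_product U i y - partial_product U (i - 1) y))\<^sup>2 \<le> squared_steps M U y"
  unfolding squared_steps_def using assms by (intro member_le_sum) auto

lemma norm_partial_product_diff_le_sum:
  "norm (partial_product U i y - y) \<le> (\<Sum>j=1..i. norm (partial_product U j y - partial_product U (j - 1) y))"
proof (induction i)
  case (Suc i)
  have "norm (partial_product U (Suc i) y - y) \<le>
      norm (partial_product U (Suc i) y - partial_product U i y) + norm (partial_product U i y - y)"
    using norm_triangle_ineq[of "partial_product U (Suc i) y - partial_product U i y" "partial_product U i y - y"]
    by simp
  then show ?case using Suc by simp
qed simp

text \<open>Keeps the intermediate points of a composition in every ball around a common fixed point that
contains the starting point.\<close>

lemma norm_partial_product_le:
  assumes "\<And>i. i \<in> {1..M} \<Longrightarrow> cutter (U i)" "z \<in> (\<Inter>i\<in>{1..M}. Fix (U i))" "i \<le> M"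
  shows "norm (partial_product U i y - z) \<le> norm (y - z)"
  using assms(3)
proof (induction i)
  case (Suc i)
  have "cutter (U (Suc i))" "z \<in> Fix (U (Suc i))" using assms(1,2) Suc.prems by auto
  then have "norm (partial_product U (Suc i) y - z) \<le> norm (partial_product U i y - z)"
    by (simp add: cutter_quasi_nonexpansive)
  with Suc show ?case by linarith
qed simp

text \<open>If \<open>p\<close> and \<open>q\<close> are consecutive points of the path, the cutter inequality says
\<open>(z - y) \<bullet> (q - p) \<ge> (q - y) \<bullet> (q - p)\<close>, and twice the right-hand side is
\<open>\<parallel>q - y\<parallel>\<^sup>2 + \<parallel>q - p\<parallel>\<^sup>2 - \<parallel>p - y\<parallel>\<^sup>2\<close>. In the sum over the path the squared distances to \<open>y\<close>
telescope.\<close>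

lemma partial_product_displacement_inner_ge:
  assumes "\<And>i. i \<in> {1..M} \<Longrightarrow> cutter (U i)" "z \<in> (\<Inter>i\<in>{1..M}. Fix (U i))"
  shows "2 * ((z - y) \<bullet> (partial_product U M y - y)) \<ge> (norm (partial_product U M y - y))\<^sup>2 + squared_steps M U y"
proof -
  have "2 * ((z - y) \<bullet> (partial_product U m y - y)) \<ge> (norm (partial_product U m y - y))\<^sup>2 + squared_steps m U y"
    if "m \<le> M" for m
    using that
  proof (induction m)
    case 0
    then show ?case by (simp add: squared_steps_def)
  next
    case (Suc m)
    define p where "p = partial_product U m y"
    define q where "q = U (Suc m) p"
    have "(z - q) \<bullet> (p - q) \<le> 0"
      unfolding q_def using assms Suc.prems by (intro cutter_inner_le) auto
    moreover have "2 * ((z - y) \<bullet> (q - y)) = 2 * ((z - y) \<bullet> (p - y)) - 2 * ((z - q) \<bullet> (p - q))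
        + ((norm (q - y))\<^sup>2 + (norm (q - p))\<^sup>2 - (norm (p - y))\<^sup>2)"
      by (simp add: power2_norm_eq_inner inner_diff inner_commute algebra_simps)
    moreover have "2 * ((z - y) \<bullet> (p - y)) \<ge> (norm (p - y))\<^sup>2 + squared_steps m U y"
      using Suc by (simp add: p_def)
    moreover have "squared_steps (Suc m) U y = squared_steps m U y + (norm (q - p))\<^sup>2"
      by (simp add: squared_steps_def p_def q_def)
    ultimately show ?case by (simp add: p_def q_def)
  qed
  then show ?thesis by simp
qed

lemma squared_steps_eq_0:
  assumes "y \<in> (\<Inter>i\<in>{1..M}. Fix (U i))"
  shows "partial_product U M y = y" "squared_steps M U y = 0"
proof -
  have *: "partial_product U i y = y" if "i \<le> M" for i
    using that
  proof (induction i)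
    case (Suc i)
    then have "y \<in> Fix (U (Suc i))" using assms by auto
    with Suc show ?case by (simp add: Fix_def)
  qed simp
  then show "partial_product U M y = y" by simp
  have "norm (partial_product U i y - partial_product U (i - 1) y) = 0" if "i \<in> {1..M}" for i
    using *[of i] *[of "i - 1"] that by auto
  then show "squared_steps M U y = 0" by (simp add: squared_steps_def)
qed

text \<open>A closed path has zero displacement, and then the previous inequality leaves no room for a step of
positive length. In particular the denominator in the extrapolation bound is nonzero off the common
fixed points.\<close>

lemma partial_product_fixed_point:
  assumes "\<And>i. i \<in> {1..M} \<Longrightarrow> cutter (U i)" "(\<Inter>i\<in>{1..M}. Fix (U i)) \<noteq> {}" "partial_product U M y = y"
  shows "y \<in> (\<Inter>i\<in>{1..M}. Fix (U i))"
proof -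
  obtain z where "z \<in> (\<Inter>i\<in>{1..M}. Fix (U i))" using assms(2) by blast
  from partial_product_displacement_inner_ge[OF assms(1) this, of y] assms(3)
  have S: "squared_steps M U y \<le> 0" by simp
  have step: "partial_product U i y = partial_product U (i - 1) y" if "i \<in> {1..M}" for i
  proof -
    have "(norm (partial_product U i y - partial_product U (i - 1) y))\<^sup>2 \<le> 0"
      using step_squared_le_squared_steps[OF that, of U y] S by (rule order_trans)
    then show ?thesis by simp
  qed
  have eq: "partial_product U i y = y" if "i \<le> M" for i
    using that
  proof (induction i)
    case (Suc i)
    then show ?case using step[of "Suc i"] by simp
  qed simp
  have "U i y = y" if "i \<in> {1..M}" for i
  proof -
    from that obtain j where "i = Suc j" "j < M" by (cases i) auto
    then show ?thesis using eq[of i] eq[of j] by simp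
  qed
  then show ?thesis by (simp add: Fix_def)
qed

text \<open>The reason for the shape of \<open>\<Theta>\<close>. With \<open>N = \<parallel>T y - y\<parallel>\<^sup>2\<close>, the equation for \<open>t\<close> is the definition of the
extrapolation bound, and the right-hand side is what the expansion of the squared distance yields.
It equals \<open>\<alpha> (t (M + 1) / M - \<alpha>) N\<close>; the left-hand side expresses it through the sum \<open>S\<close> of squared
steps, which is what the regularity of the single operators controls.\<close>

lemma extrapolated_step_identity:
  fixes \<alpha> M N S t :: real
  assumes t: "t = M / (M + 1) * (1 + S / N)" "t \<ge> 1" and "N > 0" "M > 0"
  shows "\<alpha> * ((1 + M - M * (\<alpha> / t)) / (1 + M - M / t)) * S = \<alpha> * (N + S) - \<alpha>\<^sup>2 * N"
proof -
  define num den where "num = 1 + M - M * (\<alpha> / t)" and "den = 1 + M - M / t"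
  have "M / t \<le> M" using t(2) \<open>M > 0\<close> by (simp add: divide_le_eq)
  then have "den > 0" by (simp add: den_def)
  have "t * (M + 1) = M * (1 + S / N)"
    using t(1) \<open>M > 0\<close> by (simp add: nonzero_eq_divide_eq)
  then have "t * (M + 1) * N = M * (1 + S / N) * N" by simp
  also have "\<dots> = M * (N + S)"
    using \<open>N > 0\<close> by (simp add: distrib_left distrib_right)
  finally have tM: "t * (M + 1) * N = M * (N + S)" .
  have t_den: "t * den = t * (M + 1) - M" and t_num: "t * num = t * (M + 1) - M * \<alpha>"
    using t(2) by (simp_all add: den_def num_def right_diff_distrib distrib_left)
  have "M * S = t * den * N"
    unfolding t_den using tM by (simp add: algebra_simps)
  moreover have num: "t * num * N = M * (N + S - \<alpha> * N)"
    unfolding t_num using tM by (simp add: algebra_simps)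
  moreover have "M * (\<alpha> * (num / den) * S) = \<alpha> * (num / den) * (M * S)"
    by simp
  ultimately have "M * (\<alpha> * (num / den) * S) = \<alpha> * (num / den) * (t * den * N)"
    by simp
  also have "\<dots> = \<alpha> * (t * num * N)"
    using \<open>den > 0\<close> by simp
  also have "\<dots> = M * (\<alpha> * (N + S) - \<alpha>\<^sup>2 * N)"
    unfolding num by (simp add: algebra_simps power2_eq_square)
  finally have "\<alpha> * (num / den) * S = \<alpha> * (N + S) - \<alpha>\<^sup>2 * N"
    using \<open>M > 0\<close> mult_left_cancel[of M] by blast
  then show ?thesis by (simp only: num_def den_def)
qed

text \<open>At a common fixed point the path is constant and nothing moves. Elsewhere the expansion of the square
together with the lower bound on the inner product leaves exactly the quantity of the preceding
identity.\<close>

lemma extrapolated_step_decrease: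
  fixes U :: "nat \<Rightarrow> 'a::real_inner \<Rightarrow> 'a" and M :: nat and \<alpha> :: real
  defines "\<tau> \<equiv> extrapolation M U"
  assumes "M \<ge> 1" and cutters: "\<And>i. i \<in> {1..M} \<Longrightarrow> cutter (U i)"
    and z: "z \<in> (\<Inter>i\<in>{1..M}. Fix (U i))" and "\<tau> y \<ge> 1" "\<alpha> \<ge> 0"
  shows "(norm (y + \<alpha> *\<^sub>R (partial_product U M y - y) - z))\<^sup>2 \<le> (norm (y - z))\<^sup>2
    - \<alpha> * ((1 + real M - real M * (\<alpha> / \<tau> y)) / (1 + real M - real M / \<tau> y)) * squared_steps M U y"
proof (cases "y \<in> (\<Inter>i\<in>{1..M}. Fix (U i))")
  case True
  then show ?thesis using squared_steps_eq_0[OF True] by simp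
next
  case False
  define d where "d = partial_product U M y - y"
  define S where "S = squared_steps M U y"
  define t where "t = \<tau> y"
  have "d \<noteq> 0"
  proof
    assume "d = 0"
    then have "y \<in> (\<Inter>i\<in>{1..M}. Fix (U i))"
      using z by (intro partial_product_fixed_point cutters) (auto simp: d_def)
    with False show False by contradiction
  qed
  moreover have "t = real M / (real M + 1) * (1 + S / (norm d)\<^sup>2)"
    using False by (simp only: t_def \<tau>_def extrapolation_def S_def squared_steps_def d_def if_True not_False_eq_True)
  ultimately have "\<alpha> * ((1 + real M - real M * (\<alpha> / t)) / (1 + real M - real M / t)) * S
      = \<alpha> * ((norm d)\<^sup>2 + S) - \<alpha>\<^sup>2 * (norm d)\<^sup>2"
    using \<open>\<tau> y \<ge> 1\<close> \<open>M \<ge> 1\<close> by (intro extrapolated_step_identity) (simp_all add: t_def)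
  also have "\<dots> \<le> \<alpha> * (2 * ((z - y) \<bullet> d)) - \<alpha>\<^sup>2 * (norm d)\<^sup>2"
    using partial_product_displacement_inner_ge[OF cutters z, of y] \<open>\<alpha> \<ge> 0\<close>
    by (intro diff_right_mono mult_left_mono) (simp_all add: d_def S_def)
  also have "\<dots> = (norm (y - z))\<^sup>2 - (norm (y - z + \<alpha> *\<^sub>R d))\<^sup>2"
    by (simp add: power2_norm_eq_inner inner_diff inner_add inner_commute algebra_simps
        power2_eq_square[of \<alpha>])
  finally show ?thesis by (simp add: d_def S_def t_def diff_add_eq)
qed

text \<open>The distance to \<open>Fix (U j)\<close> is at most the length of the path up to the point to which \<open>U j\<close> is
applied, plus the distance remaining there, which regularity bounds by \<open>1 / \<delta>\<close> times the next step.
Since \<open>\<delta> \<le> 1\<close>, the total is at most \<open>1 / \<delta>\<close> times the length of the whole path, and the Cauchy-Schwarz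
inequality bounds the square of that length by \<open>M\<close> times the sum of squared steps.\<close>

lemma infdist_Fix_squared_le:
  fixes U :: "nat \<Rightarrow> 'a::real_inner \<Rightarrow> 'a"
  assumes "j \<in> {1..M}" "0 < \<delta>" "\<delta> \<le> 1"
    and "\<delta> * infdist (partial_product U (j - 1) y) (Fix (U j))
          \<le> norm (partial_product U j y - partial_product U (j - 1) y)"
  shows "\<delta>\<^sup>2 * (infdist y (Fix (U j)))\<^sup>2 \<le> real M * squared_steps M U y"
proof -
  define s where "s i = norm (partial_product U i y - partial_product U (i - 1) y)" for i
  obtain i where i: "j = Suc i" using assms(1) by (cases j) auto
  have "\<delta> * infdist y (Fix (U j)) \<le> \<delta> * infdist (partial_product U i y) (Fix (U j)) + \<delta> * norm (partial_product U i y - y)"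
    using infdist_triangle[of y "Fix (U j)" "partial_product U i y"] \<open>0 < \<delta>\<close>
    by (simp add: dist_norm norm_minus_commute flip: distrib_left)
  also have "\<dots> \<le> s j + (\<Sum>k=1..i. s k)"
  proof (intro add_mono)
    show "\<delta> * infdist (partial_product U i y) (Fix (U j)) \<le> s j"
      using assms(4) by (simp add: s_def i)
    have "\<delta> * norm (partial_product U i y - y) \<le> 1 * norm (partial_product U i y - y)"
      using assms by (intro mult_right_mono) auto
    then show "\<delta> * norm (partial_product U i y - y) \<le> (\<Sum>k=1..i. s k)"
      using norm_partial_product_diff_le_sum[of U i y] by (simp add: s_def)
  qed
  also have "\<dots> = (\<Sum>k=1..j. s k)" by (simp add: i)
  also have "\<dots> \<le> (\<Sum>k=1..M. s k)"
    using assms(1) by (intro sum_mono2) (auto simp: s_def)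
  finally have "(\<delta> * infdist y (Fix (U j)))\<^sup>2 \<le> (\<Sum>k=1..M. s k)\<^sup>2"
    using \<open>0 < \<delta>\<close> by (intro power_mono) (auto simp: infdist_nonneg)
  also have "\<dots> \<le> real M * squared_steps M U y"
    using sum_squared_le_sum_of_squares[of s "{1..M}"] by (simp add: s_def squared_steps_def mult.commute)
  finally show ?thesis by (simp add: power_mult_distrib)
qed

section \<open>Regularity\<close>

lemma null_sequence_comparison:
  fixes f g :: "nat \<Rightarrow> real"
  assumes "g \<longlonglongrightarrow> 0" "\<And>k. 0 \<le> f k" "\<And>k. f k \<le> g k"
  shows "f \<longlonglongrightarrow> 0"
  by (rule tendsto_sandwich[OF _ _ tendsto_const assms(1)]) (simp_all add: assms(2,3))

lemma linearly_regular_imp_regular: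
  assumes "linearly_regular \<delta> U S"
  shows "regular U S"
  unfolding regular_def
proof (intro allI impI)
  fix x assume "\<forall>k. x k \<in> S" and lim: "(\<lambda>k. norm (U (x k) - x k)) \<longlonglongrightarrow> 0"
  then have "infdist (x k) (Fix U) \<le> norm (U (x k) - x k) / \<delta>" for k
    using assms by (simp add: linearly_regular_def le_divide_eq mult.commute)
  then show "(\<lambda>k. infdist (x k) (Fix U)) \<longlonglongrightarrow> 0"
    by (rule null_sequence_comparison[OF tendsto_divide_zero[OF lim] infdist_nonneg])
qed

lemma family_linearly_regular_imp_regular:
  assumes "family_linearly_regular \<kappa> I C S"
  shows "family_regular I C S"
  unfolding family_regular_def
proof (intro allI impI)
  fix x :: "nat \<Rightarrow> _"
  assume "\<forall>k. x k \<in> S" and lim: "(\<lambda>k. MAX i\<in>I. infdist (x k) (C i)) \<longlonglongrightarrow> 0"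
  then have "infdist (x k) (\<Inter>i\<in>I. C i) \<le> \<kappa> * (MAX i\<in>I. infdist (x k) (C i))" for k
    using assms by (simp add: family_linearly_regular_def)
  then show "(\<lambda>k. infdist (x k) (\<Inter>i\<in>I. C i)) \<longlonglongrightarrow> 0"
    by (rule null_sequence_comparison[OF tendsto_mult_right_zero[OF lim] infdist_nonneg])
qed

lemma linearly_regular_antimono:
  assumes "linearly_regular \<delta> U S" "0 < \<delta>'" "\<delta>' \<le> \<delta>"
  shows "linearly_regular \<delta>' U S"
proof -
  have "\<delta>' * infdist y (Fix U) \<le> \<delta> * infdist y (Fix U)" for y
    using assms(3) by (intro mult_right_mono infdist_nonneg)
  then show ?thesis
    using assms order_trans unfolding linearly_regular_def by blast
qed

text \<open>A cutter never moves a point farther than the distance to its fixed points, so a constant above 1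
leaves only distance zero.\<close>

lemma linearly_regular_gt_1_imp_infdist_0:
  assumes "cutter U" "linearly_regular \<delta> U S" "\<delta> > 1" "y \<in> S"
  shows "infdist y (Fix U) = 0"
proof -
  have "\<delta> * infdist y (Fix U) \<le> infdist y (Fix U)"
    using assms cutter_displacement_le_infdist[OF assms(1), of y]
    by (auto simp: linearly_regular_def intro: order_trans)
  then have "(\<delta> - 1) * infdist y (Fix U) \<le> 0" by (simp add: left_diff_distrib)
  then show ?thesis
    using \<open>\<delta> > 1\<close> infdist_nonneg[of y "Fix U"] by (simp add: mult_le_0_iff)
qed

text \<open>A negative \<open>q\<close> is allowed because \<open>q\<close> will be a value of \<^const>\<open>sqrt\<close>, which is negative on negative
arguments; it forces \<open>d\<close> to vanish.\<close>

lemma geometric_bound_of_contraction: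
  fixes d :: "nat \<Rightarrow> real"
  assumes "\<And>k. 0 \<le> d k" "\<And>k. d (Suc k) \<le> q * d k"
  shows "d k \<le> q ^ k * d 0"
proof (cases "q \<ge> 0")
  case True
  show ?thesis
  proof (induction k)
    case (Suc k)
    have "d (Suc k) \<le> q * d k" by (rule assms(2))
    also have "\<dots> \<le> q * (q ^ k * d 0)" using Suc True by (rule mult_left_mono)
    finally show ?case by simp
  qed simp
next
  case False
  have "0 \<le> q * d k" for k
    using assms(1)[of "Suc k"] assms(2)[of k] by (rule order_trans)
  then have "d k = 0" for k
    using False assms(1)[of k] by (metis antisym_conv zero_le_mult_iff)
  then show ?thesis by simp
qed

section \<open>The extrapolated iteration\<close>

locale extrapolated_cutter_iteration =
  fixes M :: nat and U :: "nat \<Rightarrow> 'a::{real_inner, complete_space} \<Rightarrow> 'a" and x :: "nat \<Rightarrow> 'a"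
    and lam :: "nat \<Rightarrow> real" and lam_lo lam_hi :: real and \<sigma> :: "nat \<Rightarrow> 'a \<Rightarrow> real"
  assumes M_pos: "M \<ge> 1"
    and cutters: "\<And>i. i \<in> {1..M} \<Longrightarrow> cutter (U i)"
    and common_fixed_point: "(\<Inter>i\<in>{1..M}. Fix (U i)) \<noteq> {}"
    and iterate: "\<And>k. x (Suc k) = x k + (lam k * \<sigma> k (x k)) *\<^sub>R (partial_product U M (x k) - x k)"
    and lam_lo: "lam_lo > 0"
    and lam_hi: "1 \<le> lam_hi" "lam_hi < 1 + 1 / real M"
    and lam: "\<And>k. lam_lo \<le> lam k" "\<And>k. lam k \<le> lam_hi"
    and extrapolation: "\<And>k y. 1 \<le> \<sigma> k y" "\<And>k y. \<sigma> k y \<le> extrapolation M U y"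
begin

abbreviation C :: "'a set" where
  "C \<equiv> \<Inter>i\<in>{1..M}. Fix (U i)"

abbreviation B :: "'a set" where
  "B \<equiv> cball (metric_projection C (x 0)) (infdist (x 0) C)"

definition \<Theta> :: "nat \<Rightarrow> real" where
  "\<Theta> k = lam k * \<sigma> k (x k) *
     ((1 + real M - real M * lam k * (\<sigma> k (x k) / extrapolation M U (x k)))
       / (1 + real M - real M / extrapolation M U (x k)))"

text \<open>A lower bound for all \<open>\<Theta> k\<close>: take the smallest relaxation in the outer factor, the largest one and
\<open>\<sigma> = \<tau>\<close> in the numerator, and \<open>\<tau> = \<infinity>\<close> in the denominator.\<close>

definition \<Theta>\<^sub>0 :: real where
  "\<Theta>\<^sub>0 = lam_lo * ((1 + real M - real M * lam_hi) / (1 + real M))"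

text \<open>The upper bound on the relaxation parameters in the form that keeps \<open>\<Theta>\<^sub>0\<close> and \<open>\<rho>\<close> positive.\<close>

lemma M_lam_hi_less: "real M * lam_hi < 1 + real M"
proof -
  have "real M * lam_hi < real M * (1 + 1 / real M)"
    using lam_hi M_pos by (intro mult_strict_left_mono) auto
  also have "\<dots> = 1 + real M" using M_pos by (simp add: distrib_left)
  finally show ?thesis .
qed

lemma \<Theta>\<^sub>0_pos: "\<Theta>\<^sub>0 > 0"
  using M_lam_hi_less lam_lo by (simp add: \<Theta>\<^sub>0_def)

lemma \<Theta>_ge: "\<Theta>\<^sub>0 \<le> \<Theta> k"
proof -
  define t s where "t = extrapolation M U (x k)" and "s = \<sigma> k (x k)"
  have st: "1 \<le> s" "s \<le> t" using extrapolation by (auto simp: s_def t_def)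
  have "real M / t \<le> real M" using st M_pos by (simp add: divide_le_eq)
  then have den: "0 < 1 + real M - real M / t" "1 + real M - real M / t \<le> 1 + real M"
    using st by auto
  have "lam k * (s / t) \<le> lam_hi * 1"
    using lam[of k] lam_lo st by (intro mult_mono) auto
  then have "real M * (lam k * (s / t)) \<le> real M * lam_hi"
    by (intro mult_left_mono) auto
  then have num: "1 + real M - real M * lam_hi \<le> 1 + real M - real M * lam k * (s / t)"
    by (simp add: mult.assoc)
  have "lam_lo * 1 \<le> lam k * s"
    using lam[of k] lam_lo st by (intro mult_mono) auto
  then have "lam_lo * ((1 + real M - real M * lam_hi) / (1 + real M))
      \<le> lam k * s * ((1 + real M - real M * lam k * (s / t)) / (1 + real M - real M / t))"
    using den num M_lam_hi_less lam_lo by (intro mult_mono frac_le) auto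
  then show ?thesis by (simp add: \<Theta>_def \<Theta>\<^sub>0_def s_def t_def)
qed

lemma \<Theta>_nonneg: "0 \<le> \<Theta> k"
  using \<Theta>\<^sub>0_pos \<Theta>_ge[of k] by linarith

lemma closed_convex_C: "closed C" "convex C"
  by (intro closed_INT convex_INT ballI cutter_Fix_closed_convex cutters; assumption)+

lemma decrease:
  assumes "z \<in> C"
  shows "(norm (x (Suc k) - z))\<^sup>2 \<le> (norm (x k - z))\<^sup>2 - \<Theta> k * squared_steps M U (x k)"
proof -
  have \<tau>: "1 \<le> extrapolation M U (x k)" using extrapolation order_trans by blast
  have \<alpha>: "0 \<le> lam k * \<sigma> k (x k)"
    using lam(1)[of k] lam_lo extrapolation(1)[of k "x k"] by (intro mult_nonneg_nonneg) linarith+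
  show ?thesis
    unfolding iterate \<Theta>_def
    using extrapolated_step_decrease[OF M_pos cutters assms \<tau> \<alpha>] by (simp add: mult.assoc)
qed

lemma Fejer: "Fejer_monotone C x"
  unfolding Fejer_monotone_def
proof (intro ballI allI)
  fix z k assume "z \<in> C"
  have "0 \<le> \<Theta> k * squared_steps M U (x k)"
    by (intro mult_nonneg_nonneg \<Theta>_nonneg squared_steps_nonneg)
  then have "(norm (x (Suc k) - z))\<^sup>2 \<le> (norm (x k - z))\<^sup>2"
    using decrease[OF \<open>z \<in> C\<close>, of k] by linarith
  then show "norm (x (Suc k) - z) \<le> norm (x k - z)"
    by (rule power2_le_imp_le) simp
qed

lemma projection: "metric_projection C y \<in> C" "dist y (metric_projection C y) = infdist y C"
  using metric_projection_closed_convex[OF closed_convex_C common_fixed_point] by auto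

lemma partial_product_in_B:
  assumes "i \<le> M"
  shows "partial_product U i (x k) \<in> B"
proof -
  have "norm (partial_product U i (x k) - metric_projection C (x 0)) \<le> norm (x k - metric_projection C (x 0))"
    by (rule norm_partial_product_le[OF cutters projection(1) assms])
  then show ?thesis
    using Fejer_monotone_in_cball[OF Fejer projection(1), of k "x 0"] projection(2)[of "x 0"]
    by (simp add: dist_norm norm_minus_commute)
qed

lemma iterate_in_B: "x k \<in> B"
  using partial_product_in_B[of 0 k] by simp

text \<open>The squared distances to a common fixed point decrease to a limit, so their consecutive differences,
which dominate \<open>\<Theta>\<^sub>0\<close> times the sums of squared steps, tend to zero.\<close>

lemma squared_steps_null: "(\<lambda>k. squared_steps M U (x k)) \<longlonglongrightarrow> 0"
proof -
  obtain z where z: "z \<in> C" using common_fixed_point by blast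
  obtain c where "(\<lambda>k. norm (x k - z)) \<longlonglongrightarrow> c"
    using decseq_convergent[OF Fejer_monotone_decseq[OF Fejer z], of 0] norm_ge_zero by blast
  then have c: "(\<lambda>k. (norm (x k - z))\<^sup>2) \<longlonglongrightarrow> c\<^sup>2" by (rule tendsto_power)
  have "(\<lambda>k. ((norm (x k - z))\<^sup>2 - (norm (x (Suc k) - z))\<^sup>2) / \<Theta>\<^sub>0) \<longlonglongrightarrow> (c\<^sup>2 - c\<^sup>2) / \<Theta>\<^sub>0"
    using \<Theta>\<^sub>0_pos by (intro tendsto_intros c LIMSEQ_Suc[OF c]) auto
  then have "(\<lambda>k. ((norm (x k - z))\<^sup>2 - (norm (x (Suc k) - z))\<^sup>2) / \<Theta>\<^sub>0) \<longlonglongrightarrow> 0" by simp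
  moreover have "squared_steps M U (x k) \<le> ((norm (x k - z))\<^sup>2 - (norm (x (Suc k) - z))\<^sup>2) / \<Theta>\<^sub>0" for k
  proof -
    have "\<Theta>\<^sub>0 * squared_steps M U (x k) \<le> \<Theta> k * squared_steps M U (x k)"
      by (intro mult_right_mono \<Theta>_ge squared_steps_nonneg)
    then show ?thesis
      using decrease[OF z, of k] \<Theta>\<^sub>0_pos by (simp add: le_divide_eq mult.commute)
  qed
  ultimately show ?thesis
    by (rule null_sequence_comparison[OF _ squared_steps_nonneg])
qed

lemma step_null:
  assumes "i \<in> {1..M}"
  shows "(\<lambda>k. partial_product U i (x k) - partial_product U (i - 1) (x k)) \<longlonglongrightarrow> 0"
proof -
  have "(\<lambda>k. (norm (partial_product U i (x k) - partial_product U (i - 1) (x k)))\<^sup>2) \<longlonglongrightarrow> 0"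
    by (rule null_sequence_comparison[OF squared_steps_null zero_le_power2 step_squared_le_squared_steps[OF assms]])
  then show ?thesis by (simp add: tendsto_norm_zero_iff)
qed

lemma partial_product_displacement_null:
  assumes "i \<le> M"
  shows "(\<lambda>k. partial_product U i (x k) - x k) \<longlonglongrightarrow> 0"
  using assms
proof (induction i)
  case (Suc i)
  then have "(\<lambda>k. (partial_product U (Suc i) (x k) - partial_product U (Suc i - 1) (x k))
      + (partial_product U i (x k) - x k)) \<longlonglongrightarrow> 0 + 0"
    by (intro tendsto_add step_null) auto
  then show ?case by simp
qed simp

text \<open>The operator \<open>U i\<close> is applied in the iteration at the points \<open>partial_product U (i - 1) (x k)\<close>. These
have the same weak cluster points as the iterates and are moved less and less by \<open>U i\<close>, so weak
regularity makes every cluster point a fixed point.\<close>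

theorem weak_convergence:
  assumes "\<And>i. i \<in> {1..M} \<Longrightarrow> weakly_regular (U i) B"
  obtains l where "l \<in> C \<inter> B" "weakly_converges x l"
proof -
  have cluster: "l \<in> C" if r: "strict_mono (r :: nat \<Rightarrow> nat)" and l: "weakly_converges (x \<circ> r) l" for r l
  proof
    fix i assume i: "i \<in> {1..M}"
    define y where "y k = partial_product U (i - 1) (x (r k))" for k
    have "(\<lambda>k. y k - (x \<circ> r) k) \<longlonglongrightarrow> 0"
      using LIMSEQ_subseq_LIMSEQ[OF partial_product_displacement_null r, of "i - 1"] i
      by (auto simp: y_def o_def)
    then have "weakly_converges y l" by (rule weakly_converges_add_null[OF l])
    moreover have "U i (y k) = partial_product U i (x (r k))" for k
      using i by (cases i) (auto simp: y_def)
    then have "(\<lambda>k. U i (y k) - y k) \<longlonglongrightarrow> 0"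
      using LIMSEQ_subseq_LIMSEQ[OF step_null[OF i] r] by (simp add: y_def o_def)
    moreover have "y k \<in> B" for k
      unfolding y_def using i by (intro partial_product_in_B) auto
    ultimately show "l \<in> Fix (U i)"
      using assms[OF i] unfolding weakly_regular_def by blast
  qed
  show thesis
  proof (rule Fejer_monotone_weakly_convergent[OF Fejer common_fixed_point])
    show "l \<in> C" if "strict_mono r" "weakly_converges (x \<circ> r) l" for r l
      using that by (rule cluster)
    fix l assume l: "l \<in> C" "weakly_converges x l"
    show thesis
      by (rule that[OF IntI[OF l(1) weak_limit_in_cball[OF l(2) iterate_in_B]] l(2)])
  qed
qed

text \<open>Regularity gives the vanishing of the distances to \<open>Fix (U i)\<close> at the points where \<open>U i\<close> is
applied; as these points approach the iterates, the same holds along the iterates.\<close>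

theorem strong_convergence:
  assumes regular: "\<And>i. i \<in> {1..M} \<Longrightarrow> regular (U i) B"
    and family: "family_regular {1..M} (\<lambda>i. Fix (U i)) B"
  obtains l where "l \<in> C \<inter> B" "x \<longlonglongrightarrow> l"
proof -
  have null: "(\<lambda>k. infdist (x k) (Fix (U i))) \<longlonglongrightarrow> 0" if i: "i \<in> {1..M}" for i
  proof -
    define y where "y k = partial_product U (i - 1) (x k)" for k
    have "U i (y k) = partial_product U i (x k)" for k
      using i by (cases i) (auto simp: y_def)
    then have "(\<lambda>k. norm (U i (y k) - y k)) \<longlonglongrightarrow> 0"
      using step_null[OF i] by (simp add: y_def tendsto_norm_zero_iff)
    moreover have "y k \<in> B" for k
      unfolding y_def using i by (intro partial_product_in_B) auto
    ultimately have "(\<lambda>k. infdist (y k) (Fix (U i))) \<longlonglongrightarrow> 0"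
      using regular[OF i] unfolding regular_def by blast
    moreover have "(\<lambda>k. norm (y k - x k)) \<longlonglongrightarrow> 0"
      unfolding y_def tendsto_norm_zero_iff using i by (intro partial_product_displacement_null) auto
    ultimately have "(\<lambda>k. infdist (y k) (Fix (U i)) + norm (y k - x k)) \<longlonglongrightarrow> 0"
      by (rule tendsto_add_zero)
    moreover have "infdist (x k) (Fix (U i)) \<le> infdist (y k) (Fix (U i)) + norm (y k - x k)" for k
      using infdist_triangle[of "x k" "Fix (U i)" "y k"] by (simp add: dist_norm norm_minus_commute)
    ultimately show ?thesis
      by (rule null_sequence_comparison[OF _ infdist_nonneg])
  qed
  have "(\<lambda>k. MAX i\<in>{1..M}. infdist (x k) (Fix (U i))) \<longlonglongrightarrow> 0"
  proof (rule null_sequence_comparison)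
    show "(\<lambda>k. \<Sum>i\<in>{1..M}. infdist (x k) (Fix (U i))) \<longlonglongrightarrow> 0"
      by (rule tendsto_null_sum) (rule null)
    show "(MAX i\<in>{1..M}. infdist (x k) (Fix (U i))) \<le> (\<Sum>i\<in>{1..M}. infdist (x k) (Fix (U i)))" for k
    proof (rule Max.boundedI)
      fix v assume "v \<in> (\<lambda>i. infdist (x k) (Fix (U i))) ` {1..M}"
      then obtain i where "i \<in> {1..M}" "v = infdist (x k) (Fix (U i))" by blast
      then show "v \<le> (\<Sum>i\<in>{1..M}. infdist (x k) (Fix (U i)))"
        using member_le_sum[of i "{1..M}" "\<lambda>i. infdist (x k) (Fix (U i))"] by (simp add: infdist_nonneg)
    qed (use M_pos in auto)
    have "infdist (x k) (Fix (U 1)) \<le> (MAX i\<in>{1..M}. infdist (x k) (Fix (U i)))" for k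
      using M_pos by (intro Max_ge) auto
    then show "0 \<le> (MAX i\<in>{1..M}. infdist (x k) (Fix (U i)))" for k
      using infdist_nonneg order_trans by blast
  qed
  then have "(\<lambda>k. infdist (x k) C) \<longlonglongrightarrow> 0"
    using family iterate_in_B unfolding family_regular_def by blast
  then obtain l where l: "l \<in> C" "x \<longlonglongrightarrow> l"
    using Fejer_monotone_convergent[OF Fejer common_fixed_point closed_convex_C(1)] by blast
  moreover have "l \<in> B"
    using closed_sequentially[OF closed_cball iterate_in_B l(2)] .
  ultimately show ?thesis using that by blast
qed

lemma infdist_common_le_infdist_Fix:
  assumes "family_linearly_regular \<kappa> {1..M} (\<lambda>i. Fix (U i)) B" "y \<in> B"
  obtains j where "j \<in> {1..M}" "infdist y C \<le> \<kappa> * infdist y (Fix (U j))"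
proof -
  have "(MAX i\<in>{1..M}. infdist y (Fix (U i))) \<in> (\<lambda>i. infdist y (Fix (U i))) ` {1..M}"
    using M_pos by (intro Max_in) auto
  then obtain j where "j \<in> {1..M}" "(MAX i\<in>{1..M}. infdist y (Fix (U i))) = infdist y (Fix (U j))"
    by auto
  moreover have "infdist y C \<le> \<kappa> * (MAX i\<in>{1..M}. infdist y (Fix (U i)))"
    using assms unfolding family_linearly_regular_def by blast
  ultimately show ?thesis using that by metis
qed

text \<open>The main case is \<open>\<delta> \<le> 1\<close>, where the decrease \<open>\<Theta> k\<close> times the sum of squared steps is at least
\<open>\<Theta> k * \<delta>\<^sup>2 / (M * \<kappa>\<^sup>2)\<close> times the squared distance to \<open>C\<close>, which dominates the
stated proportion because \<open>0 \<le> \<rho> \<le> 1\<close>. If \<open>\<delta> > 1\<close>, the distance is already zero.\<close>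

lemma infdist_contraction:
  defines "\<rho> \<equiv> 1 / (real M * lam_hi) + (1 - lam_hi) / lam_hi"
  assumes linear: "\<And>i. i \<in> {1..M} \<Longrightarrow> linearly_regular \<delta> (U i) B"
    and family: "family_linearly_regular \<kappa> {1..M} (\<lambda>i. Fix (U i)) B"
  shows "(infdist (x (Suc k)) C)\<^sup>2
    \<le> (1 - \<rho> * \<delta>\<^sup>2 / (real M * \<kappa>\<^sup>2) * min (1 / \<delta>\<^sup>2) (INF k. \<Theta> k)) * (infdist (x k) C)\<^sup>2"
proof -
  define d where "d k = infdist (x k) C" for k
  define S where "S = squared_steps M U (x k)"
  define m where "m = min (1 / \<delta>\<^sup>2) (INF k. \<Theta> k)"
  define z where "z = metric_projection C (x k)"
  obtain j where j: "j \<in> {1..M}" "d k \<le> \<kappa> * infdist (x k) (Fix (U j))"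
    using infdist_common_le_infdist_Fix[OF family iterate_in_B] by (auto simp: d_def)
  have "\<delta> > 0" "\<kappa> > 0"
    using linear[OF j(1)] family by (auto simp: linearly_regular_def family_linearly_regular_def)
  \<comment> \<open>The decrease towards the point of \<open>C\<close> nearest to \<open>x k\<close> bounds the new distance to \<open>C\<close>.\<close>
  have "(d (Suc k))\<^sup>2 \<le> (norm (x (Suc k) - z))\<^sup>2"
    unfolding d_def z_def using infdist_le[OF projection(1)]
    by (intro power_mono) (auto simp: infdist_nonneg dist_norm)
  also have "\<dots> \<le> (norm (x k - z))\<^sup>2 - \<Theta> k * S"
    unfolding z_def S_def by (intro decrease projection)
  also have "norm (x k - z) = d k"
    using projection(2)[of "x k"] by (simp add: z_def d_def dist_norm)
  finally have step: "(d (Suc k))\<^sup>2 \<le> (d k)\<^sup>2 - \<Theta> k * S" .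
  have S0: "0 \<le> S" by (simp add: S_def squared_steps_nonneg)
  have "\<rho> * \<delta>\<^sup>2 / (real M * \<kappa>\<^sup>2) * m * (d k)\<^sup>2 \<le> \<Theta> k * S"
  proof (cases "\<delta> \<le> 1")
    case True
    have "bdd_below (range \<Theta>)" by (rule bdd_belowI2[OF \<Theta>_nonneg])
    then have "m \<le> \<Theta> k" unfolding m_def by (intro min.coboundedI2 cINF_lower) auto
    have "0 \<le> (INF k. \<Theta> k)" using \<Theta>_nonneg by (intro cINF_greatest) auto
    then have "0 \<le> m" by (simp add: m_def)
    have "\<rho> \<ge> 0" "\<rho> \<le> 1"
    proof -
      have \<rho>: "\<rho> = (1 + real M - real M * lam_hi) / (real M * lam_hi)"
        using M_pos lam_hi by (simp add: \<rho>_def field_simps)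
      show "\<rho> \<ge> 0" unfolding \<rho> using M_lam_hi_less lam_hi by (intro divide_nonneg_nonneg) auto
      have "1 \<le> real M * lam_hi" "real M * 1 \<le> real M * lam_hi"
        using M_pos lam_hi mult_mono[of 1 "real M" 1 lam_hi] by (auto intro!: mult_left_mono)
      then show "\<rho> \<le> 1" unfolding \<rho> by (subst divide_le_eq_1_pos) linarith+
    qed
    have "U j (partial_product U (j - 1) (x k)) = partial_product U j (x k)"
      using j(1) by (cases j) auto
    moreover have "partial_product U (j - 1) (x k) \<in> B"
      using j(1) by (intro partial_product_in_B) auto
    ultimately have "\<delta> * infdist (partial_product U (j - 1) (x k)) (Fix (U j))
        \<le> norm (partial_product U j (x k) - partial_product U (j - 1) (x k))"
      using linear[OF j(1)] unfolding linearly_regular_def by metis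
    then have "\<delta>\<^sup>2 * (infdist (x k) (Fix (U j)))\<^sup>2 \<le> real M * S"
      unfolding S_def by (rule infdist_Fix_squared_le[OF j(1) \<open>\<delta> > 0\<close> True])
    then have "\<kappa>\<^sup>2 * (\<delta>\<^sup>2 * (infdist (x k) (Fix (U j)))\<^sup>2) \<le> \<kappa>\<^sup>2 * (real M * S)"
      by (rule mult_left_mono) simp
    then have "\<delta>\<^sup>2 * (\<kappa> * infdist (x k) (Fix (U j)))\<^sup>2 \<le> real M * \<kappa>\<^sup>2 * S"
      by (simp add: power_mult_distrib mult_ac)
    moreover have "(d k)\<^sup>2 \<le> (\<kappa> * infdist (x k) (Fix (U j)))\<^sup>2"
      using j(2) by (intro power_mono) (auto simp: d_def infdist_nonneg)
    ultimately have "\<delta>\<^sup>2 * (d k)\<^sup>2 \<le> real M * \<kappa>\<^sup>2 * S"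
      by (meson mult_left_mono order_trans zero_le_power2)
    then have "\<delta>\<^sup>2 * (d k)\<^sup>2 / (real M * \<kappa>\<^sup>2) \<le> S"
      using M_pos \<open>\<kappa> > 0\<close> by (simp add: divide_le_eq mult.commute)
    then have "\<rho> * m * (\<delta>\<^sup>2 * (d k)\<^sup>2 / (real M * \<kappa>\<^sup>2)) \<le> 1 * m * S"
      using \<open>\<rho> \<ge> 0\<close> \<open>\<rho> \<le> 1\<close> \<open>0 \<le> m\<close> by (intro mult_mono) auto
    also have "\<dots> \<le> \<Theta> k * S"
      using \<open>m \<le> \<Theta> k\<close> S0 by (simp add: mult_right_mono)
    finally show ?thesis by (simp add: mult.commute mult.left_commute)
  next
    case False
    then have "infdist (x k) (Fix (U j)) = 0"
      using linear[OF j(1)] cutters[OF j(1)] iterate_in_B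
      by (intro linearly_regular_gt_1_imp_infdist_0[where S = B]) auto
    then have "d k = 0" using j(2) by (simp add: d_def antisym infdist_nonneg)
    then show ?thesis using \<Theta>_nonneg[of k] S0 by simp
  qed
  then show ?thesis
    using step unfolding m_def d_def by (simp add: left_diff_distrib)
qed

text \<open>The lower error bound holds because \<open>\<parallel>x k - l\<parallel>\<close> is at most twice the distance to \<open>C\<close>, which linear
regularity of the family and of the operators bounds by the residuals; the upper one is the cutter
inequality at \<open>l \<in> C\<close>. The rate is the contraction of the distance to \<open>C\<close>, again up to the factor 2.\<close>

theorem linear_convergence:
  defines "\<rho> \<equiv> 1 / (real M * lam_hi) + (1 - lam_hi) / lam_hi"
  assumes linear: "\<And>i. i \<in> {1..M} \<Longrightarrow> linearly_regular \<delta> (U i) B"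
    and family: "family_linearly_regular \<kappa> {1..M} (\<lambda>i. Fix (U i)) B"
  obtains l where "l \<in> C \<inter> B" "x \<longlonglongrightarrow> l"
    "\<And>k. \<delta> / (2 * \<kappa>) * norm (x k - l) \<le> (MAX i\<in>{1..M}. norm (U i (x k) - x k))"
    "\<And>k. (MAX i\<in>{1..M}. norm (U i (x k) - x k)) \<le> norm (x k - l)"
    "\<And>k. norm (x k - l) \<le> 2 * infdist (x 0) C *
       (sqrt (1 - \<rho> * \<delta>\<^sup>2 / (real M * \<kappa>\<^sup>2) * min (1 / \<delta>\<^sup>2) (INF k. \<Theta> k))) ^ k"
proof -
  define q where "q = 1 - \<rho> * \<delta>\<^sup>2 / (real M * \<kappa>\<^sup>2) * min (1 / \<delta>\<^sup>2) (INF k. \<Theta> k)"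
  obtain l where l: "l \<in> C \<inter> B" "x \<longlonglongrightarrow> l"
    using strong_convergence linearly_regular_imp_regular[OF linear]
      family_linearly_regular_imp_regular[OF family] by blast
  have dist_l: "norm (x k - l) \<le> 2 * infdist (x k) C" for k
    using Fejer_monotone_dist_limit_le[OF Fejer common_fixed_point l(2)] by (simp add: dist_norm)
  show ?thesis
  proof (rule that[OF l])
    fix k
    show "(MAX i\<in>{1..M}. norm (U i (x k) - x k)) \<le> norm (x k - l)"
    proof (rule Max.boundedI)
      fix v assume "v \<in> (\<lambda>i. norm (U i (x k) - x k)) ` {1..M}"
      then obtain i where "i \<in> {1..M}" "v = norm (U i (x k) - x k)" by blast
      with l(1) show "v \<le> norm (x k - l)"
        using cutter_displacement_le[OF cutters] by blast
    qed (use M_pos in auto)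
    obtain j where j: "j \<in> {1..M}" "infdist (x k) C \<le> \<kappa> * infdist (x k) (Fix (U j))"
      using infdist_common_le_infdist_Fix[OF family iterate_in_B] by blast
    have "\<delta> > 0" "\<kappa> > 0" and lin: "\<delta> * infdist (x k) (Fix (U j)) \<le> norm (U j (x k) - x k)"
      using linear[OF j(1)] family iterate_in_B
      by (auto simp: linearly_regular_def family_linearly_regular_def)
    have "norm (x k - l) \<le> 2 * \<kappa> * infdist (x k) (Fix (U j))"
      using dist_l[of k] j(2) by simp
    then have "\<delta> / (2 * \<kappa>) * norm (x k - l) \<le> \<delta> / (2 * \<kappa>) * (2 * \<kappa> * infdist (x k) (Fix (U j)))"
      using \<open>\<delta> > 0\<close> \<open>\<kappa> > 0\<close> by (intro mult_left_mono) auto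
    also have "\<dots> = \<delta> * infdist (x k) (Fix (U j))" using \<open>\<kappa> > 0\<close> by simp
    also have "\<dots> \<le> (MAX i\<in>{1..M}. norm (U i (x k) - x k))"
      using j(1) by (intro order_trans[OF lin] Max_ge) auto
    finally show "\<delta> / (2 * \<kappa>) * norm (x k - l) \<le> (MAX i\<in>{1..M}. norm (U i (x k) - x k))" .
    have "infdist (x (Suc k)) C \<le> sqrt q * infdist (x k) C" for k
    proof -
      have "(infdist (x (Suc k)) C)\<^sup>2 \<le> q * (infdist (x k) C)\<^sup>2"
        unfolding q_def \<rho>_def by (intro infdist_contraction linear family)
      then have "sqrt ((infdist (x (Suc k)) C)\<^sup>2) \<le> sqrt (q * (infdist (x k) C)\<^sup>2)"
        by (rule real_sqrt_le_mono)
      then show ?thesis by (simp only: real_sqrt_mult real_sqrt_abs abs_of_nonneg[OF infdist_nonneg])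
    qed
    then have "infdist (x k) C \<le> sqrt q ^ k * infdist (x 0) C"
      by (intro geometric_bound_of_contraction[of "\<lambda>k. infdist (x k) C"] infdist_nonneg)
    then show "norm (x k - l) \<le> 2 * infdist (x 0) C * (sqrt (1 - \<rho> * \<delta>\<^sup>2 / (real M * \<kappa>\<^sup>2) *
        min (1 / \<delta>\<^sup>2) (INF k. \<Theta> k))) ^ k"
      using dist_l[of k] by (simp add: q_def mult.commute)
  qed
qed

end

theorem corollary4p3:
  fixes M :: nat
    and U :: "nat \<Rightarrow> 'a::{real_inner, complete_space} \<Rightarrow> 'a"
    and x :: "nat \<Rightarrow> 'a"
    and lam :: "nat \<Rightarrow> real"
    and lam_lo lam_hi :: real
    and \<sigma> :: "nat \<Rightarrow> 'a \<Rightarrow> real"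
    and \<delta>s :: "nat \<Rightarrow> real"
    and \<kappa> :: real
  defines "C \<equiv> (\<Inter>i\<in>{1..M}. Fix (U i))"
  defines "\<tau> \<equiv> extrapolation M U"
  defines "r \<equiv> infdist (x 0) C"
  defines "B \<equiv> cball (metric_projection C (x 0)) r"
  defines "\<delta> \<equiv> (MIN i\<in>{1..M}. \<delta>s i)"
  defines "\<rho> \<equiv> 1 / (real M * lam_hi) + (1 - lam_hi) / lam_hi"
  defines "\<Theta> \<equiv> (\<lambda>k. lam k * \<sigma> k (x k) *
             ((1 + real M - real M * lam k * (\<sigma> k (x k) / \<tau> (x k)))
              / (1 + real M - real M / \<tau> (x k))))"
  assumes "M \<ge> 1"
    and "\<And>i. i \<in> {1..M} \<Longrightarrow> cutter (U i)"
    and "C \<noteq> {}"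
    and "\<And>k. x (Suc k) = x k + (lam k * \<sigma> k (x k)) *\<^sub>R (partial_product U M (x k) - x k)"
    and "\<And>k. lam k > 0"
    and "\<And>k y. \<sigma> k y \<ge> 1"
    and "lam_lo \<in> {0<..1}"
    and "lam_hi \<in> {1..<1 + 1 / real M}"
    and "\<And>k. lam k \<in> {lam_lo..lam_hi}"
    and "\<And>k y. \<sigma> k y \<in> {1..\<tau> y}"
  shows
    "((\<forall>i\<in>{1..M}. weakly_regular (U i) B) \<longrightarrow>
        (\<exists>l\<in>C \<inter> B. weakly_converges x l))
     \<and>
     ((\<forall>i\<in>{1..M}. regular (U i) B) \<and> family_regular {1..M} (\<lambda>i. Fix (U i)) B \<longrightarrow>
        (\<exists>l\<in>C \<inter> B. x \<longlonglongrightarrow> l))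
     \<and>
     ((\<forall>i\<in>{1..M}. linearly_regular (\<delta>s i) (U i) B) \<and>
        family_linearly_regular \<kappa> {1..M} (\<lambda>i. Fix (U i)) B \<longrightarrow>
        (\<exists>l\<in>C \<inter> B. x \<longlonglongrightarrow> l \<and>
           (\<forall>k. \<delta> / (2 * \<kappa>) * norm (x k - l) \<le> (MAX i\<in>{1..M}. norm (U i (x k) - x k)) \<and>
                (MAX i\<in>{1..M}. norm (U i (x k) - x k)) \<le> norm (x k - l) \<and>
                norm (x k - l) \<le> 2 * infdist (x 0) C *
                  (sqrt (1 - \<rho> * \<delta>\<^sup>2 / (real M * \<kappa>\<^sup>2) * min (1 / \<delta>\<^sup>2) (INF k. \<Theta> k))) ^ k)))"
proof -
  interpret it: extrapolated_cutter_iteration M U x lam lam_lo lam_hi \<sigma>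
    using assms(8-17) by unfold_locales (auto simp: C_def \<tau>_def)
  have \<Theta>: "\<Theta> = it.\<Theta>"
    by (simp add: fun_eq_iff \<Theta>_def it.\<Theta>_def \<tau>_def)
  note B = B_def[unfolded r_def C_def]
  show ?thesis
  proof (intro conjI impI)
    assume "\<forall>i\<in>{1..M}. weakly_regular (U i) B"
    then show "\<exists>l\<in>C \<inter> B. weakly_converges x l"
      using it.weak_convergence unfolding B C_def by blast
  next
    assume "(\<forall>i\<in>{1..M}. regular (U i) B) \<and> family_regular {1..M} (\<lambda>i. Fix (U i)) B"
    then show "\<exists>l\<in>C \<inter> B. x \<longlonglongrightarrow> l"
      using it.strong_convergence unfolding B C_def by blast
  next
    assume *: "(\<forall>i\<in>{1..M}. linearly_regular (\<delta>s i) (U i) B) \<and>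
        family_linearly_regular \<kappa> {1..M} (\<lambda>i. Fix (U i)) B"
    \<comment> \<open>The smallest of the constants serves all the operators.\<close>
    have "\<delta> \<in> \<delta>s ` {1..M}"
      unfolding \<delta>_def using \<open>M \<ge> 1\<close> by (intro Min_in) auto
    then have "\<delta> > 0" using * by (auto simp: linearly_regular_def)
    moreover have "\<delta> \<le> \<delta>s i" if "i \<in> {1..M}" for i
      unfolding \<delta>_def using that by (intro Min_le) auto
    ultimately have linear: "linearly_regular \<delta> (U i) B" if "i \<in> {1..M}" for i
      using * that linearly_regular_antimono by blast
    show "\<exists>l\<in>C \<inter> B. x \<longlonglongrightarrow> l \<and>
           (\<forall>k. \<delta> / (2 * \<kappa>) * norm (x k - l) \<le> (MAX i\<in>{1..M}. norm (U i (x k) - x k)) \<and>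
                (MAX i\<in>{1..M}. norm (U i (x k) - x k)) \<le> norm (x k - l) \<and>
                norm (x k - l) \<le> 2 * infdist (x 0) C *
                  (sqrt (1 - \<rho> * \<delta>\<^sup>2 / (real M * \<kappa>\<^sup>2) * min (1 / \<delta>\<^sup>2) (INF k. \<Theta> k))) ^ k)"
      using it.linear_convergence[OF linear[unfolded B] *[THEN conjunct2, unfolded B]]
      unfolding B C_def \<Theta> \<rho>_def by metis
  qed
qed

end
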